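(* Let $(G,\omega)$ be a nilpotent symplectic Lie group (of any even dimension), i.e. a nilpotent Lie group $G$ endowed with a left-invariant symplectic form $\omega$. Then $G$ admits a left-invariant torsion free symplectic connection $\nabla$ (i.e. $\nabla\omega=0$) which is Ricci flat, that is, $\operatorname{ric}^\nabla=0$.
   Context: The Ricci tensor of a torsion free connection $\nabla$ with curvature $R(X,Y)=[\nabla_X,\nabla_Y]-\nabla_{[X,Y]}$ is $\operatorname{ric}^\nabla(X,Y)=\mathrm{tr}\{Z\mapsto R(X,Z)Y\}$. *)

theory Defs
  imports "HOL-Analysis.Analysis" "HOL-Library.Function_Algebras"
begin

text \<open>
  Functions carry the pointwise algebra structure of \<^theory>\<open>HOL-Library.Function_Algebras\<close>; with
  the pointwise scalar multiplication, tangent vectors and vector fields become elements of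
  real vector spaces, so that the library notions of span and basis apply to them.
\<close>

instantiation "fun" :: (type, real_vector) real_vector
begin

definition scaleR_fun :: "real \<Rightarrow> ('a \<Rightarrow> 'b) \<Rightarrow> 'a \<Rightarrow> 'b" where
  "scaleR_fun c f = (\<lambda>x. c *\<^sub>R f x)"

instance
  by standard (simp_all add: scaleR_fun_def plus_fun_def scaleR_add_right scaleR_add_left)

end


section \<open>Smooth manifolds\<close>

primrec ck_on :: "nat \<Rightarrow> 'e set \<Rightarrow> ('e::real_normed_vector \<Rightarrow> 'f::real_normed_vector) \<Rightarrow> bool"
  where
    "ck_on 0 S f \<longleftrightarrow> continuous_on S f"
  | "ck_on (Suc k) S f \<longleftrightarrow> (\<forall>x\<in>S. f differentiable (at x)) \<and>
       (\<forall>v. ck_on k S (\<lambda>x. frechet_derivative f (at x) v))"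

text \<open>Only meant for open \<open>S\<close> and a finite-dimensional domain.\<close>

definition smooth_on :: "'e set \<Rightarrow> ('e::real_normed_vector \<Rightarrow> 'f::real_normed_vector) \<Rightarrow> bool"
  where "smooth_on S f \<longleftrightarrow> (\<forall>k. ck_on k S f)"

text \<open>
  A chart is a pair \<open>(U, \<phi>)\<close> of its domain and its coordinate map; only the values of \<open>\<phi>\<close> on \<open>U\<close>
  matter. An atlas is not required to be maximal.
\<close>

type_synonym ('a, 'e) atlas = "('a set \<times> ('a \<Rightarrow> 'e)) set"

definition chart :: "'a::topological_space set \<Rightarrow> ('a \<Rightarrow> 'e::euclidean_space) \<Rightarrow> bool" where
  "chart U \<phi> \<longleftrightarrow> open U \<and> open (\<phi> ` U) \<and> homeomorphism U (\<phi> ` U) \<phi> (inv_into U \<phi>)"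

definition smooth_atlas :: "('a::topological_space, 'e::euclidean_space) atlas \<Rightarrow> bool" where
  "smooth_atlas A \<longleftrightarrow>
     (\<forall>(U, \<phi>)\<in>A. chart U \<phi>) \<and>
     (\<Union>(U, \<phi>)\<in>A. U) = UNIV \<and>
     (\<forall>(U, \<phi>)\<in>A. \<forall>(V, \<psi>)\<in>A. smooth_on (\<phi> ` (U \<inter> V)) (\<psi> \<circ> inv_into U \<phi>))"

definition smooth_map ::
  "('a::topological_space, 'e::euclidean_space) atlas \<Rightarrow>
   ('b::topological_space, 'f::euclidean_space) atlas \<Rightarrow> ('a \<Rightarrow> 'b) \<Rightarrow> bool" where
  "smooth_map A B f \<longleftrightarrow> continuous_on UNIV f \<and>
     (\<forall>(U, \<phi>)\<in>A. \<forall>(V, \<psi>)\<in>B. smooth_on (\<phi> ` (U \<inter> f -` V)) (\<psi> \<circ> f \<circ> inv_into U \<phi>))"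

definition prod_atlas :: "('a, 'e) atlas \<Rightarrow> ('b, 'f) atlas \<Rightarrow> ('a \<times> 'b, 'e \<times> 'f) atlas" where
  "prod_atlas A B = (\<lambda>((U, \<phi>), (V, \<psi>)). (U \<times> V, map_prod \<phi> \<psi>)) ` (A \<times> B)"

definition smooth_functions ::
  "('a::topological_space, 'e::euclidean_space) atlas \<Rightarrow> ('a \<Rightarrow> real) set" where
  "smooth_functions A = {f. smooth_map A {(UNIV, \<lambda>x. x)} f}"


section \<open>Tangent vectors and vector fields\<close>

text \<open>
  Tangent vectors at \<open>p\<close> are derivations at \<open>p\<close> of the algebra of smooth functions. Since
  functions are total, they are normalised to be \<open>0\<close> on functions that are not smooth.
\<close>

type_synonym 'a tangent = "('a \<Rightarrow> real) \<Rightarrow> real"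
type_synonym 'a vfield = "('a \<Rightarrow> real) \<Rightarrow> 'a \<Rightarrow> real"

definition tangent_space ::
  "('a::topological_space, 'e::euclidean_space) atlas \<Rightarrow> 'a \<Rightarrow> 'a tangent set" where
  "tangent_space A p = {u.
     (\<forall>f\<in>smooth_functions A. \<forall>g\<in>smooth_functions A.
        u (f + g) = u f + u g \<and> u (f * g) = u f * g p + f p * u g) \<and>
     (\<forall>c. \<forall>f\<in>smooth_functions A. u (c *\<^sub>R f) = c * u f) \<and>
     (\<forall>f. f \<notin> smooth_functions A \<longrightarrow> u f = 0)}"

text \<open>A vector field is represented by its action on functions.\<close>

definition value_at :: "'a vfield \<Rightarrow> 'a \<Rightarrow> 'a tangent" where
  "value_at X p = (\<lambda>f. X f p)"

definition vector_fields ::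
  "('a::topological_space, 'e::euclidean_space) atlas \<Rightarrow> 'a vfield set" where
  "vector_fields A = {X. (\<forall>p. value_at X p \<in> tangent_space A p) \<and>
     (\<forall>f\<in>smooth_functions A. X f \<in> smooth_functions A)}"

definition fun_scale :: "('a \<Rightarrow> real) \<Rightarrow> 'a vfield \<Rightarrow> 'a vfield" where
  "fun_scale f X = (\<lambda>h. f * X h)"

definition lie_bracket :: "'a vfield \<Rightarrow> 'a vfield \<Rightarrow> 'a vfield" where
  "lie_bracket X Y = (\<lambda>f. X (Y f) - Y (X f))"


section \<open>Symplectic forms\<close>

type_synonym 'a two_tensor = "'a \<Rightarrow> 'a tangent \<Rightarrow> 'a tangent \<Rightarrow> real"

definition tensor_app :: "'a two_tensor \<Rightarrow> 'a vfield \<Rightarrow> 'a vfield \<Rightarrow> 'a \<Rightarrow> real" where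
  "tensor_app \<omega> X Y = (\<lambda>p. \<omega> p (value_at X p) (value_at Y p))"

definition two_form ::
  "('a::topological_space, 'e::euclidean_space) atlas \<Rightarrow> 'a two_tensor \<Rightarrow> bool" where
  "two_form A \<omega> \<longleftrightarrow>
     (\<forall>p. \<forall>u\<in>tangent_space A p. \<forall>v\<in>tangent_space A p. \<forall>w\<in>tangent_space A p. \<forall>c.
        \<omega> p (u + v) w = \<omega> p u w + \<omega> p v w \<and>
        \<omega> p (c *\<^sub>R u) w = c * \<omega> p u w \<and>
        \<omega> p u v = - \<omega> p v u) \<and>
     (\<forall>X\<in>vector_fields A. \<forall>Y\<in>vector_fields A. tensor_app \<omega> X Y \<in> smooth_functions A)"

definition exterior_derivative ::
  "'a two_tensor \<Rightarrow> 'a vfield \<Rightarrow> 'a vfield \<Rightarrow> 'a vfield \<Rightarrow> 'a \<Rightarrow> real" where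
  "exterior_derivative \<omega> X Y Z =
     X (tensor_app \<omega> Y Z) - Y (tensor_app \<omega> X Z) + Z (tensor_app \<omega> X Y)
     - tensor_app \<omega> (lie_bracket X Y) Z + tensor_app \<omega> (lie_bracket X Z) Y
     - tensor_app \<omega> (lie_bracket Y Z) X"

definition symplectic_form ::
  "('a::topological_space, 'e::euclidean_space) atlas \<Rightarrow> 'a two_tensor \<Rightarrow> bool" where
  "symplectic_form A \<omega> \<longleftrightarrow> two_form A \<omega> \<and>
     (\<forall>p. \<forall>u\<in>tangent_space A p. (\<forall>v\<in>tangent_space A p. \<omega> p u v = 0) \<longrightarrow> u = 0) \<and>
     (\<forall>X\<in>vector_fields A. \<forall>Y\<in>vector_fields A. \<forall>Z\<in>vector_fields A.
        exterior_derivative \<omega> X Y Z = 0)"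


section \<open>Connections and their Ricci tensor\<close>

type_synonym 'a conn = "'a vfield \<Rightarrow> 'a vfield \<Rightarrow> 'a vfield"

definition connection ::
  "('a::topological_space, 'e::euclidean_space) atlas \<Rightarrow> 'a conn \<Rightarrow> bool" where
  "connection A D \<longleftrightarrow>
     (\<forall>X\<in>vector_fields A. \<forall>Y\<in>vector_fields A. \<forall>Z\<in>vector_fields A. \<forall>f\<in>smooth_functions A.
        D X Y \<in> vector_fields A \<and>
        D (X + Y) Z = D X Z + D Y Z \<and>
        D (fun_scale f X) Y = fun_scale f (D X Y) \<and>
        D X (Y + Z) = D X Y + D X Z \<and>
        D X (fun_scale f Y) = fun_scale (X f) Y + fun_scale f (D X Y))"

definition torsion_free ::
  "('a::topological_space, 'e::euclidean_space) atlas \<Rightarrow> 'a conn \<Rightarrow> bool" where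
  "torsion_free A D \<longleftrightarrow>
     (\<forall>X\<in>vector_fields A. \<forall>Y\<in>vector_fields A. D X Y - D Y X = lie_bracket X Y)"

definition covariant_derivative ::
  "'a conn \<Rightarrow> 'a two_tensor \<Rightarrow> 'a vfield \<Rightarrow> 'a vfield \<Rightarrow> 'a vfield \<Rightarrow> 'a \<Rightarrow> real" where
  "covariant_derivative D \<omega> X Y Z =
     X (tensor_app \<omega> Y Z) - tensor_app \<omega> (D X Y) Z - tensor_app \<omega> Y (D X Z)"

definition symplectic_connection ::
  "('a::topological_space, 'e::euclidean_space) atlas \<Rightarrow> 'a two_tensor \<Rightarrow> 'a conn \<Rightarrow> bool" where
  "symplectic_connection A \<omega> D \<longleftrightarrow>
     (\<forall>X\<in>vector_fields A. \<forall>Y\<in>vector_fields A. \<forall>Z\<in>vector_fields A.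
        covariant_derivative D \<omega> X Y Z = 0)"

definition curvature :: "'a conn \<Rightarrow> 'a vfield \<Rightarrow> 'a vfield \<Rightarrow> 'a vfield \<Rightarrow> 'a vfield" where
  "curvature D X Y Z = D X (D Y Z) - D Y (D X Z) - D (lie_bracket X Y) Z"

text \<open>
  Trace of an endomorphism \<open>T\<close> of a finite-dimensional subspace \<open>V\<close>, computed in some basis of
  \<open>V\<close>; it does not depend on the basis.
\<close>

definition trace_on :: "'v::real_vector set \<Rightarrow> ('v \<Rightarrow> 'v) \<Rightarrow> real" where
  "trace_on V T = (let B = (SOME B. B \<subseteq> V \<and> independent B \<and> span B = V)
                   in \<Sum>b\<in>B. representation B (T b) b)"

definition extend_field ::
  "('a::topological_space, 'e::euclidean_space) atlas \<Rightarrow> 'a \<Rightarrow> 'a tangent \<Rightarrow> 'a vfield" where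
  "extend_field A p u = (SOME Z. Z \<in> vector_fields A \<and> value_at Z p = u)"

text \<open>
  The value at \<open>p\<close> of the trace of \<open>Z \<mapsto> R(X, Z) Y\<close>. As the curvature is tensorial, the choice of a
  vector field extending a tangent vector at \<open>p\<close> is immaterial.
\<close>

definition ricci ::
  "('a::topological_space, 'e::euclidean_space) atlas \<Rightarrow> 'a conn \<Rightarrow> 'a vfield \<Rightarrow> 'a vfield \<Rightarrow>
   'a \<Rightarrow> real" where
  "ricci A D X Y p =
     trace_on (tangent_space A p) (\<lambda>u. value_at (curvature D X (extend_field A p u) Y) p)"

definition ricci_flat ::
  "('a::topological_space, 'e::euclidean_space) atlas \<Rightarrow> 'a conn \<Rightarrow> bool" where
  "ricci_flat A D \<longleftrightarrow> (\<forall>X\<in>vector_fields A. \<forall>Y\<in>vector_fields A. \<forall>p. ricci A D X Y p = 0)"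


section \<open>Lie groups and left-invariance\<close>

definition lie_group ::
  "('g::{t2_space,second_countable_topology}, 'e::euclidean_space) atlas \<Rightarrow>
   ('g \<Rightarrow> 'g \<Rightarrow> 'g) \<Rightarrow> 'g \<Rightarrow> ('g \<Rightarrow> 'g) \<Rightarrow> bool" where
  "lie_group A mul e iv \<longleftrightarrow>
     smooth_atlas A \<and> group mul e iv \<and>
     smooth_map (prod_atlas A A) A (\<lambda>(x, y). mul x y) \<and> smooth_map A A iv"

text \<open>
  Differentials of the left translation \<open>L\<^sub>g = mul g\<close>, whose inverse is \<open>mul (iv g)\<close>: on tangent
  vectors, \<open>(dL\<^sub>g u) f = u (f \<circ> L\<^sub>g)\<close>, and on vector fields,
  \<open>(L\<^sub>g)\<^sub>* X\<close> sends \<open>f\<close> to \<open>X (f \<circ> L\<^sub>g) \<circ> mul (iv g)\<close>.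
\<close>

definition push_tangent :: "('g \<Rightarrow> 'g \<Rightarrow> 'g) \<Rightarrow> 'g \<Rightarrow> 'g tangent \<Rightarrow> 'g tangent" where
  "push_tangent mul g u = (\<lambda>f. u (f \<circ> mul g))"

definition push_field ::
  "('g \<Rightarrow> 'g \<Rightarrow> 'g) \<Rightarrow> ('g \<Rightarrow> 'g) \<Rightarrow> 'g \<Rightarrow> 'g vfield \<Rightarrow> 'g vfield" where
  "push_field mul iv g X = (\<lambda>f. X (f \<circ> mul g) \<circ> mul (iv g))"

definition left_invariant_form ::
  "('g::topological_space, 'e::euclidean_space) atlas \<Rightarrow> ('g \<Rightarrow> 'g \<Rightarrow> 'g) \<Rightarrow> 'g two_tensor \<Rightarrow> bool"
  where
  "left_invariant_form A mul \<omega> \<longleftrightarrow>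
     (\<forall>g p. \<forall>u\<in>tangent_space A p. \<forall>v\<in>tangent_space A p.
        \<omega> (mul g p) (push_tangent mul g u) (push_tangent mul g v) = \<omega> p u v)"

definition left_invariant_connection ::
  "('g::topological_space, 'e::euclidean_space) atlas \<Rightarrow> ('g \<Rightarrow> 'g \<Rightarrow> 'g) \<Rightarrow> ('g \<Rightarrow> 'g) \<Rightarrow>
   'g conn \<Rightarrow> bool" where
  "left_invariant_connection A mul iv D \<longleftrightarrow>
     (\<forall>g. \<forall>X\<in>vector_fields A. \<forall>Y\<in>vector_fields A.
        D (push_field mul iv g X) (push_field mul iv g Y) = push_field mul iv g (D X Y))"

definition lie_algebra ::
  "('g::topological_space, 'e::euclidean_space) atlas \<Rightarrow> ('g \<Rightarrow> 'g \<Rightarrow> 'g) \<Rightarrow> ('g \<Rightarrow> 'g) \<Rightarrow>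
   'g vfield set" where
  "lie_algebra A mul iv = {X \<in> vector_fields A. \<forall>g. push_field mul iv g X = X}"

primrec lower_central_series :: "'g vfield set \<Rightarrow> nat \<Rightarrow> 'g vfield set" where
  "lower_central_series L 0 = L"
| "lower_central_series L (Suc k) =
     span {lie_bracket X Y | X Y. X \<in> L \<and> Y \<in> lower_central_series L k}"

text \<open>
  A Lie group is nilpotent if its Lie algebra is. For connected groups this is the same as
  nilpotency of the abstract group; in general it is implied by the latter.
\<close>

definition nilpotent_lie_group ::
  "('g::{t2_space,second_countable_topology}, 'e::euclidean_space) atlas \<Rightarrow>
   ('g \<Rightarrow> 'g \<Rightarrow> 'g) \<Rightarrow> 'g \<Rightarrow> ('g \<Rightarrow> 'g) \<Rightarrow> bool" where
  "nilpotent_lie_group A mul e iv \<longleftrightarrow> lie_group A mul e iv \<and>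
     (\<exists>k. lower_central_series (lie_algebra A mul iv) k = {0})"

end

theory Submission
  imports Defs
begin

text \<open>
  On the Lie algebra, let \<open>x \<cdot> y\<close> be the left-symmetric product determined by
  \<open>\<omega>(x \<cdot> y, z) = - \<omega>(y, [x, z])\<close>. It is a flat torsion-free connection, and its projection to the
  symplectic connections is \<open>\<nabla>\<^sub>x y = ([x, y] + x \<cdot> y) / 3\<close>. With \<open>r\<^sub>x z = \<nabla>\<^sub>z x\<close>, torsion-freeness gives
  \<open>ric(x, y) = tr (r\<^sub>x r\<^sub>y) - tr r\<^bsub>\<nabla>\<^sub>x y\<^esub>\<close>. For a nilpotent algebra the traces of \<open>ad\<^sub>x\<close> and of
  \<open>ad\<^sub>x ad\<^sub>y\<close> vanish, which kills all terms except the trace of \<open>(x \<cdot>) ad\<^sub>y + ad\<^sub>x (y \<cdot>)\<close>. That trace vanishes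
  because the right multiplications of a left-symmetric algebra satisfy \<open>tr (R\<^sub>x R\<^sub>y) = tr R\<^bsub>y \<cdot> x\<^esub> = 0\<close>.

  To extend the connection from left-invariant to arbitrary vector fields one needs a smooth left-invariant
  frame. Cutting off Hadamard's expansion with a bump function shows that derivations at the identity are
  combinations of partial derivatives in a chart; hence they span a finite-dimensional space and translate to
  smooth vector fields. The coefficients with respect to the frame are smooth because they are
  values of \<open>\<omega>\<close> on an \<open>\<omega>\<close>-dual frame.
\<close>

section \<open>Smooth functions on open sets\<close>

text \<open>The constant 1/3 is that of the usual symplectization of a torsion-free connection
  \<nabla>: define N by \<omega>(N(x, y), z) = (\<nabla>_x \<omega>)(y, z) and add (N(x, y) + N(y,
  x)) / 3. For the product x \<cdot> y one finds N(x, y) = [x, y] - x \<cdot> y = - y \<cdot> x, and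
  x \<cdot> y - (x \<cdot> y + y \<cdot> x) / 3 equals ([x, y] + x \<cdot> y) / 3. The definitions
  dictate the analytic part. Tangent vectors are abstract derivations, and \<open>ricci\<close>
  picks by \<open>SOME\<close> both a basis of the tangent space and a global vector field through
  each tangent vector. Finite dimension and the existence of extensions therefore have to be known
  before the trace can be computed; left translation of derivations at the identity gives the
  extensions, and the frame they form is global. Identities between arbitrary vector fields then
  follow from those in the Lie algebra, one slot at a time, by tensoriality.\<close>

lemma ck_on_cong:
  assumes "open S" "\<And>x. x \<in> S \<Longrightarrow> f x = g x" "ck_on k S f"
  shows "ck_on k S g"
  using assms(2,3)
proof (induction k arbitrary: f g)
  case 0
  then show ?case by (simp cong: continuous_on_cong)
next
  case (Suc k)
  have d: "f differentiable (at x)" if "x \<in> S" for x using Suc.prems(2) that by simp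
  have "g differentiable (at x)" if "x \<in> S" for x
    using has_derivative_transform_within_open[of f _ x UNIV S g] d[OF that] \<open>open S\<close> that Suc.prems(1)
    by (auto simp: differentiable_def)
  moreover have "ck_on k S (\<lambda>x. frechet_derivative g (at x) v)" for v
  proof (rule Suc.IH)
    show "ck_on k S (\<lambda>x. frechet_derivative f (at x) v)" using Suc.prems(2) by simp
    show "frechet_derivative f (at x) v = frechet_derivative g (at x) v" if "x \<in> S" for x
      using frechet_derivative_transform_within_open[OF d[OF that] \<open>open S\<close> that Suc.prems(1)]
      by simp
  qed
  ultimately show ?case by simp
qed

text \<open>The definition of \<open>ck_on\<close> refers to the chosen
  \<open>frechet_derivative\<close>; this form accepts any derivative formula valid on an open
  \<open>S\<close>. Most closure properties below are inductions on \<open>k\<close> through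
  it.\<close>

lemma ck_on_SucI:
  assumes "open S" "\<And>x. x \<in> S \<Longrightarrow> (f has_derivative f' x) (at x)" "\<And>v. ck_on k S (\<lambda>x. f' x v)"
  shows "ck_on (Suc k) S f"
proof -
  have "ck_on k S (\<lambda>x. frechet_derivative f (at x) v)" for v
    by (rule ck_on_cong[OF assms(1) _ assms(3)[of v]])
      (use frechet_derivative_at[OF assms(2)] in simp)
  then show ?thesis using assms(2) by (auto simp: differentiable_def)
qed

lemma ck_on_SucD:
  assumes "ck_on (Suc k) S f" "x \<in> S"
  shows "(f has_derivative frechet_derivative f (at x)) (at x)"
  using assms by (simp flip: frechet_derivative_works)

lemma ck_on_subset: "ck_on k S f \<Longrightarrow> T \<subseteq> S \<Longrightarrow> ck_on k T f"
  by (induction k arbitrary: f) (auto intro: continuous_on_subset)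

lemma ck_on_Suc_imp: "ck_on (Suc k) S f \<Longrightarrow> ck_on k S f"
proof (induction k arbitrary: f)
  case 0
  then show ?case
    by (auto intro!: continuous_at_imp_continuous_on differentiable_imp_continuous_within)
next
  case (Suc k)
  then show ?case by (metis ck_on.simps(2))
qed

lemma ck_on_imp_continuous: "ck_on k S f \<Longrightarrow> continuous_on S f"
  by (induction k) (auto dest: ck_on_Suc_imp simp del: ck_on.simps(2))

lemma ck_on_locally:
  assumes "\<And>x. x \<in> S \<Longrightarrow> \<exists>T. open T \<and> x \<in> T \<and> ck_on k T f"
  shows "ck_on k S f"
  using assms
proof (induction k arbitrary: f)
  case 0
  have "continuous (at x within S) f" if x: "x \<in> S" for x
  proof -
    obtain T where "open T" "x \<in> T" "continuous_on T f" using 0[OF x] by auto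
    then show ?thesis by (metis continuous_on_eq_continuous_at continuous_at_imp_continuous_within)
  qed
  then show ?case by (simp add: continuous_on_eq_continuous_within)
next
  case (Suc k)
  have "f differentiable (at x)" if "x \<in> S" for x using Suc.prems[OF that] by auto
  moreover have "ck_on k S (\<lambda>x. frechet_derivative f (at x) v)" for v
    by (rule Suc.IH) (use Suc.prems in fastforce)
  ultimately show ?case by simp
qed

lemma ck_on_const: "open S \<Longrightarrow> ck_on k S (\<lambda>x. c)"
  by (induction k arbitrary: c) (auto simp del: ck_on.simps(2) intro!: ck_on_SucI derivative_eq_intros)

lemma ck_on_bounded_linear: "bounded_linear f \<Longrightarrow> open S \<Longrightarrow> ck_on k S f"
  by (cases k) (auto simp del: ck_on.simps(2) intro!: ck_on_SucI bounded_linear_imp_has_derivative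
      ck_on_const linear_continuous_on)

lemma ck_on_add:
  assumes "open S"
  shows "ck_on k S f \<Longrightarrow> ck_on k S g \<Longrightarrow> ck_on k S (\<lambda>x. f x + g x)"
proof (induction k arbitrary: f g)
  case 0
  then show ?case by (auto intro: continuous_intros)
next
  case (Suc k)
  show ?case
    by (rule ck_on_SucI[OF assms has_derivative_add[OF ck_on_SucD ck_on_SucD]])
      (use Suc in auto)
qed

lemma ck_on_sum:
  assumes "open S" "\<And>i. i \<in> I \<Longrightarrow> ck_on k S (f i)"
  shows "ck_on k S (\<lambda>x. \<Sum>i\<in>I. f i x)"
proof (cases "finite I")
  case True
  then show ?thesis using assms(2) by (induction I) (auto intro: ck_on_const ck_on_add assms(1))
qed (simp add: ck_on_const assms(1))

lemma ck_on_scaleR: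
  assumes "open S"
  shows "ck_on k S f \<Longrightarrow> ck_on k S g \<Longrightarrow> ck_on k S (\<lambda>x. f x *\<^sub>R g x)"
proof (induction k arbitrary: f g)
  case 0
  then show ?case by (auto intro: continuous_intros)
next
  case (Suc k)
  show ?case
  proof (rule ck_on_SucI[OF assms has_derivative_scaleR[OF ck_on_SucD[OF Suc.prems(1)] ck_on_SucD[OF Suc.prems(2)]]])
    fix v
    show "ck_on k S (\<lambda>x. f x *\<^sub>R frechet_derivative g (at x) v + frechet_derivative f (at x) v *\<^sub>R g x)"
      using Suc.prems Suc.prems[THEN ck_on_Suc_imp] by (intro ck_on_add assms Suc.IH) auto
  qed
qed

lemma ck_on_linear_compose:
  assumes "open S" "bounded_linear L"
  shows "ck_on k S f \<Longrightarrow> ck_on k S (\<lambda>x. L (f x))"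
proof (induction k arbitrary: f)
  case 0
  then show ?case using assms(2) by (auto intro: bounded_linear.continuous_on)
next
  case (Suc k)
  show ?case
    by (rule ck_on_SucI[OF assms(1) bounded_linear.has_derivative[OF assms(2) ck_on_SucD]])
      (use Suc in auto)
qed

text \<open>In the chain rule both the base point and the direction of the derivative of
  \<open>g\<close> move with \<open>x\<close>, whereas \<open>ck_on\<close> differentiates in fixed
  directions. Expanding the direction in \<open>Basis\<close> leaves a finite sum of products
  covered by the induction hypothesis; hence the Euclidean codomain of \<open>f\<close>.\<close>

lemma ck_on_compose:
  fixes f :: "'a::real_normed_vector \<Rightarrow> 'b::euclidean_space"
  assumes "open S" "open T"
  shows "ck_on k T g \<Longrightarrow> ck_on k S f \<Longrightarrow> f ` S \<subseteq> T \<Longrightarrow> ck_on k S (\<lambda>x. g (f x))"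
proof (induction k arbitrary: f g)
  case 0
  then show ?case by (auto intro: continuous_on_compose2)
next
  case (Suc k)
  let ?g' = "\<lambda>x. frechet_derivative g (at (f x))" and ?f' = "\<lambda>x. frechet_derivative f (at x)"
  show ?case
  proof (rule ck_on_SucI[OF assms(1)])
    show "((\<lambda>x. g (f x)) has_derivative (\<lambda>v. \<Sum>b\<in>Basis. (?f' x v \<bullet> b) *\<^sub>R ?g' x b)) (at x)"
      if "x \<in> S" for x
    proof -
      have "f x \<in> T" using Suc.prems(3) that by auto
      note g = ck_on_SucD[OF Suc.prems(1) this]
      have "?g' x (?f' x v) = (\<Sum>b\<in>Basis. (?f' x v \<bullet> b) *\<^sub>R ?g' x b)" for v
      proof -
        have "?g' x (?f' x v) = ?g' x (\<Sum>b\<in>Basis. (?f' x v \<bullet> b) *\<^sub>R b)"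
          by (simp add: euclidean_representation)
        also have "\<dots> = (\<Sum>b\<in>Basis. (?f' x v \<bullet> b) *\<^sub>R ?g' x b)"
          using has_derivative_linear[OF g] by (simp add: linear_sum linear_scale)
        finally show ?thesis .
      qed
      then show ?thesis
        using diff_chain_at[OF ck_on_SucD[OF Suc.prems(2) that] g] by (simp add: o_def)
    qed
    show "ck_on k S (\<lambda>x. \<Sum>b\<in>Basis. (?f' x v \<bullet> b) *\<^sub>R ?g' x b)" for v
    proof (intro ck_on_sum ck_on_scaleR assms)
      fix b :: 'b assume "b \<in> Basis"
      show "ck_on k S (\<lambda>x. ?f' x v \<bullet> b)"
        by (rule ck_on_linear_compose[OF assms(1) bounded_linear_inner_left]) (use Suc.prems in simp)
      show "ck_on k S (\<lambda>x. ?g' x b)"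
        by (rule Suc.IH) (use Suc.prems Suc.prems(2)[THEN ck_on_Suc_imp] in auto)
    qed
  qed
qed

lemma ck_on_Pair:
  assumes "open S"
  shows "ck_on k S f \<Longrightarrow> ck_on k S g \<Longrightarrow> ck_on k S (\<lambda>x. (f x, g x))"
proof (induction k arbitrary: f g)
  case 0
  then show ?case by (auto intro: continuous_intros)
next
  case (Suc k)
  show ?case
    by (rule ck_on_SucI[OF assms has_derivative_Pair[OF ck_on_SucD ck_on_SucD]])
      (use Suc in auto)
qed

lemma smooth_on_cong:
  "open S \<Longrightarrow> (\<And>x. x \<in> S \<Longrightarrow> f x = g x) \<Longrightarrow> smooth_on S f \<Longrightarrow> smooth_on S g"
  unfolding smooth_on_def using ck_on_cong by blast

lemma smooth_on_subset: "smooth_on S f \<Longrightarrow> T \<subseteq> S \<Longrightarrow> smooth_on T f"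
  unfolding smooth_on_def using ck_on_subset by blast

lemma smooth_on_locally:
  "(\<And>x. x \<in> S \<Longrightarrow> \<exists>T. open T \<and> x \<in> T \<and> smooth_on T f) \<Longrightarrow> smooth_on S f"
  unfolding smooth_on_def by (metis ck_on_locally)

lemma smooth_on_imp_continuous: "smooth_on S f \<Longrightarrow> continuous_on S f"
  unfolding smooth_on_def using ck_on_imp_continuous by blast

lemma smooth_on_has_derivative:
  assumes "smooth_on S f" "x \<in> S"
  shows "(f has_derivative frechet_derivative f (at x)) (at x)"
  using assms unfolding smooth_on_def by (metis ck_on_SucD)

lemma smooth_on_derivative: "smooth_on S f \<Longrightarrow> smooth_on S (\<lambda>x. frechet_derivative f (at x) v)"
  unfolding smooth_on_def by (metis ck_on.simps(2))

lemma smooth_on_const: "open S \<Longrightarrow> smooth_on S (\<lambda>x. c)"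
  by (simp add: smooth_on_def ck_on_const)

lemma smooth_on_bounded_linear: "bounded_linear f \<Longrightarrow> open S \<Longrightarrow> smooth_on S f"
  by (simp add: smooth_on_def ck_on_bounded_linear)

lemma smooth_on_add:
  "open S \<Longrightarrow> smooth_on S f \<Longrightarrow> smooth_on S g \<Longrightarrow> smooth_on S (\<lambda>x. f x + g x)"
  by (simp add: smooth_on_def ck_on_add)

lemma smooth_on_sum:
  "open S \<Longrightarrow> (\<And>i. i \<in> I \<Longrightarrow> smooth_on S (f i)) \<Longrightarrow> smooth_on S (\<lambda>x. \<Sum>i\<in>I. f i x)"
  by (simp add: smooth_on_def ck_on_sum)

lemma smooth_on_mult:
  fixes f g :: "'a::real_normed_vector \<Rightarrow> real"
  shows "open S \<Longrightarrow> smooth_on S f \<Longrightarrow> smooth_on S g \<Longrightarrow> smooth_on S (\<lambda>x. f x * g x)"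
  using ck_on_scaleR[of S _ f g] by (simp add: smooth_on_def)

lemma smooth_on_linear_compose:
  "open S \<Longrightarrow> bounded_linear L \<Longrightarrow> smooth_on S f \<Longrightarrow> smooth_on S (\<lambda>x. L (f x))"
  by (simp add: smooth_on_def ck_on_linear_compose)

lemma smooth_on_compose:
  fixes f :: "'a::real_normed_vector \<Rightarrow> 'b::euclidean_space"
  shows "open S \<Longrightarrow> open T \<Longrightarrow> smooth_on T g \<Longrightarrow> smooth_on S f \<Longrightarrow> f ` S \<subseteq> T \<Longrightarrow> smooth_on S (\<lambda>x. g (f x))"
  by (simp add: smooth_on_def ck_on_compose)

lemma smooth_on_Pair:
  "open S \<Longrightarrow> smooth_on S f \<Longrightarrow> smooth_on S g \<Longrightarrow> smooth_on S (\<lambda>x. (f x, g x))"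
  by (simp add: smooth_on_def ck_on_Pair)

section \<open>Bump functions and Hadamard's lemma\<close>

lemma poly_over_exp_tendsto_0: "((\<lambda>y::real. poly p y * exp (- y)) \<longlongrightarrow> 0) at_top"
proof -
  have "((\<lambda>y. \<Sum>i\<le>degree p. coeff p i * (y ^ i / exp y)) \<longlongrightarrow> (\<Sum>i\<le>degree p. coeff p i * 0)) at_top"
    by (intro tendsto_intros tendsto_power_div_exp_0)
  then show ?thesis
    by (simp add: poly_altdef sum_distrib_right exp_minus divide_inverse mult.assoc)
qed

text \<open>This family contains \<open>exp (- 1 / t)\<close> and is closed under differentiation.\<close>

definition flat_exp :: "real poly \<Rightarrow> real \<Rightarrow> real" where
  "flat_exp p t = (if t > 0 then poly p (1 / t) * exp (- (1 / t)) else 0)"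

lemma flat_exp_tendsto_0: "(flat_exp p \<longlongrightarrow> 0) (at 0)"
proof (rule filterlim_split_at)
  show "(flat_exp p \<longlongrightarrow> 0) (at_left 0)"
    by (rule tendsto_eventually) (auto simp: flat_exp_def eventually_at_left_field intro: exI[of _ "-1"])
  have "((\<lambda>t. poly p (inverse t) * exp (- inverse t)) \<longlongrightarrow> 0) (at_right 0)"
    by (rule filterlim_compose[OF poly_over_exp_tendsto_0 filterlim_inverse_at_top_right])
  then show "(flat_exp p \<longlongrightarrow> 0) (at_right 0)"
    by (rule Lim_transform_eventually)
      (auto simp: flat_exp_def eventually_at_right_field inverse_eq_divide intro: exI[of _ 1])
qed

text \<open>With y = 1/t the function is p(y) exp(-y), and its t-derivative is y^2 (p - p')(y)
  exp(-y), which gives the new polynomial. At 0 the difference quotient is again in the family, with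
  p(y) replaced by y p(y), so its limit is known.\<close>

lemma flat_exp_has_derivative:
  "(flat_exp p has_real_derivative flat_exp (monom 1 2 * (p - pderiv p)) t) (at t)"
proof -
  consider "t > 0" | "t < 0" | "t = 0" by linarith
  then show ?thesis
  proof cases
    case 1
    have "((\<lambda>t. poly p (1 / t) * exp (- (1 / t))) has_real_derivative
       flat_exp (monom 1 2 * (p - pderiv p)) t) (at t)"
      using 1 by (auto intro!: derivative_eq_intros DERIV_chain'[of _ _ _ _ "poly p"] poly_DERIV
          simp: flat_exp_def poly_monom field_simps power2_eq_square)
    then show ?thesis
      by (rule has_field_derivative_transform_within_open[of _ _ _ "{0<..}"])
        (use 1 in \<open>auto simp: flat_exp_def\<close>)
  next
    case 2
    have "((\<lambda>t. 0) has_real_derivative flat_exp (monom 1 2 * (p - pderiv p)) t) (at t)"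
      using 2 by (auto simp: flat_exp_def)
    then show ?thesis
      by (rule has_field_derivative_transform_within_open[of _ _ _ "{..<0}"])
        (use 2 in \<open>auto simp: flat_exp_def\<close>)
  next
    case 3
    have "(\<lambda>x. (flat_exp p x - flat_exp p 0) / (x - 0)) = flat_exp (pCons 0 p)"
      by (auto simp: flat_exp_def fun_eq_iff)
    then show ?thesis
      using flat_exp_tendsto_0[of "pCons 0 p"] 3
      by (simp add: has_field_derivative_iff flat_exp_def)
  qed
qed

lemma smooth_on_flat_exp: "smooth_on UNIV (flat_exp p)"
proof -
  have "ck_on k UNIV (flat_exp p)" for k
  proof (induction k arbitrary: p)
    case 0
    show ?case
      unfolding ck_on.simps by (rule DERIV_continuous_on[OF has_field_derivative_at_within[OF flat_exp_has_derivative]])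
  next
    case (Suc k)
    show ?case
    proof (rule ck_on_SucI)
      show "(flat_exp p has_derivative (*) (flat_exp (monom 1 2 * (p - pderiv p)) x)) (at x)" for x
        using flat_exp_has_derivative[of p x]
        by (simp add: has_field_derivative_def)
      show "ck_on k UNIV (\<lambda>x. flat_exp (monom 1 2 * (p - pderiv p)) x * v)" for v
        using ck_on_linear_compose[OF _ bounded_linear_mult_left Suc.IH] by simp
    qed simp
  qed
  then show ?thesis by (simp add: smooth_on_def)
qed

lemma bump_function_exists:
  fixes x0 :: "'e::euclidean_space"
  assumes "r > 0"
  obtains \<beta> :: "'e \<Rightarrow> real"
  where "smooth_on UNIV \<beta>" "\<beta> x0 = 1" "\<forall>x. x \<notin> ball x0 r \<longrightarrow> \<beta> x = 0"
proof
  define q where "q = (\<lambda>x::'e. r\<^sup>2 - (x - x0) \<bullet> (x - x0))"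
  \<comment> \<open>At \<open>x0\<close> the argument \<open>q\<close> equals
    \<open>r\<^sup>2\<close>, and the prefactor normalises the value there to 1.\<close>
  define \<beta> where "\<beta> = (\<lambda>x. 1 / exp (- (1 / r\<^sup>2)) * flat_exp 1 (q x))"
  have lin: "smooth_on UNIV (\<lambda>x::'e. (x - x0) \<bullet> b)" for b
  proof -
    have "smooth_on UNIV (\<lambda>x::'e. x \<bullet> b + - (x0 \<bullet> b))"
      by (intro smooth_on_add smooth_on_const smooth_on_bounded_linear bounded_linear_inner_left) auto
    then show ?thesis by (simp add: inner_diff_left)
  qed
  have "smooth_on UNIV (\<lambda>x. r\<^sup>2 + (\<Sum>b\<in>Basis. - (((x - x0) \<bullet> b) * ((x - x0) \<bullet> b))))"
    by (intro smooth_on_add smooth_on_const smooth_on_sum smooth_on_mult lin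
        smooth_on_linear_compose[OF _ bounded_linear_minus[OF bounded_linear_ident]]) auto
  also have "(\<lambda>x. r\<^sup>2 + (\<Sum>b\<in>Basis. - (((x - x0) \<bullet> b) * ((x - x0) \<bullet> b)))) = q"
    unfolding q_def by (rule ext, subst euclidean_inner) (simp add: sum_negf)
  finally have "smooth_on UNIV q" .
  then show "smooth_on UNIV \<beta>"
    unfolding \<beta>_def
    by (intro smooth_on_linear_compose[OF _ bounded_linear_mult_right]
        smooth_on_compose[OF _ _ smooth_on_flat_exp]) auto
  show "\<beta> x0 = 1" using assms by (simp add: \<beta>_def q_def flat_exp_def)
  show "\<forall>x. x \<notin> ball x0 r \<longrightarrow> \<beta> x = 0"
  proof (intro allI impI)
    fix x assume "x \<notin> ball x0 r"
    then have "r \<le> norm (x - x0)" by (simp add: dist_norm norm_minus_commute)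
    then have "r\<^sup>2 \<le> (norm (x - x0))\<^sup>2" using assms by (intro power_mono) auto
    then have "q x \<le> 0" by (simp add: q_def power2_norm_eq_inner)
    then show "\<beta> x = 0" by (simp add: \<beta>_def flat_exp_def)
  qed
qed

text \<open>Differentiation under the integral brings out the inner derivative \<open>t\<close>, so
  an unweighted claim would not reproduce itself. With an arbitrary weight it does:
  \<open>c t\<close> becomes \<open>c t * t\<close>. Convexity keeps the segments from
  \<open>x0\<close> inside \<open>S\<close>.\<close>

lemma ck_on_radial_integral:
  fixes H :: "'e::euclidean_space \<Rightarrow> real"
  assumes "open S" "convex S" "x0 \<in> S"
  shows "continuous_on {0..1} c \<Longrightarrow> ck_on k S H \<Longrightarrow>
    ck_on k S (\<lambda>x. integral {0..1::real} (\<lambda>t. c t * H (x0 + t *\<^sub>R (x - x0))))"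
proof (induction k arbitrary: c H)
  have mem: "x0 + t *\<^sub>R (x - x0) \<in> S" if "x \<in> S" "t \<in> {0..1}" for x t
  proof -
    have "(1 - t) *\<^sub>R x0 + t *\<^sub>R x \<in> S" using that assms by (intro convexD) auto
    then show ?thesis by (simp add: algebra_simps)
  qed
  have cont: "continuous_on (S \<times> {0..1}) (\<lambda>(x, t). c t *\<^sub>R H (x0 + t *\<^sub>R (x - x0)))"
    if "continuous_on {0..1} c" "continuous_on S H"
    for c :: "real \<Rightarrow> real" and H :: "'e \<Rightarrow> 'f::real_normed_vector"
    unfolding split_beta
    by (intro continuous_intros continuous_on_compose2[OF that(1)] continuous_on_compose2[OF that(2)])
      (auto intro: mem)
  {
    case 0
    then have "continuous_on (S \<times> cbox 0 1) (\<lambda>(x, t). c t * H (x0 + t *\<^sub>R (x - x0)))"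
      using cont[of c H] by simp
    then show ?case
      using integral_continuous_on_param[of S 0 1 "\<lambda>x t. c t * H (x0 + t *\<^sub>R (x - x0))"] by simp
  next
    case (Suc k)
    \<comment> \<open>\<open>leibniz_rule\<close> takes the derivative as a continuous map into
      bounded linear maps. In finite dimension that follows from continuity in each fixed direction,
      which is what \<open>ck_on\<close> provides.\<close>
    define J where "J = (\<lambda>z. Blinfun (frechet_derivative H (at z)))"
    have HJ: "(H has_derivative blinfun_apply (J z)) (at z)"
      and J: "blinfun_apply (J z) = frechet_derivative H (at z)" if "z \<in> S" for z
      using ck_on_SucD[OF Suc.prems(2) that]
      by (simp_all add: J_def bounded_linear_Blinfun_apply has_derivative_bounded_linear)
    have contJ: "continuous_on S J"
    proof (rule continuous_on_blinfun_componentwise)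
      fix i :: 'e
      have "continuous_on S (\<lambda>x. frechet_derivative H (at x) i)"
        using Suc.prems(2) by (auto intro: ck_on_imp_continuous)
      then show "continuous_on S (\<lambda>x. blinfun_apply (J x) i)"
        by (rule continuous_on_eq) (simp add: J)
    qed
    have Pair_cont: "continuous_on {0..1::real} (Pair x)" for x :: 'e
      by (rule continuous_on_Pair[OF continuous_on_const continuous_on_id])
    define fx where "fx = (\<lambda>x t. (c t * t) *\<^sub>R J (x0 + t *\<^sub>R (x - x0)))"
    have cont_fx: "continuous_on (S \<times> cbox 0 1) (\<lambda>(x, t). fx x t)"
      using cont[OF _ contJ, of "\<lambda>t. c t * t"] Suc.prems(1) by (simp add: fx_def continuous_on_mult continuous_on_id)
    have int: "fx x integrable_on {0..1}" if "x \<in> S" for x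
    proof -
      have "continuous_on {0..1} (fx x)"
        using continuous_on_compose2[OF cont_fx Pair_cont[of x]] that by (simp add: image_subset_iff)
      then show ?thesis by (simp add: integrable_continuous_interval)
    qed
    have der: "((\<lambda>x. integral {0..1::real} (\<lambda>t. c t * H (x0 + t *\<^sub>R (x - x0)))) has_derivative
        integral {0..1} (fx y)) (at y)" if y: "y \<in> S" for y
    proof -
      have "((\<lambda>x. integral (cbox 0 1) (\<lambda>t. c t * H (x0 + t *\<^sub>R (x - x0)))) has_derivative
        integral (cbox 0 1) (fx y)) (at y within S)"
      proof (rule leibniz_rule[OF _ _ cont_fx y assms(2)])
        fix x t assume x: "x \<in> S" and t: "t \<in> cbox (0::real) 1"
        have g: "((\<lambda>x. x0 + t *\<^sub>R (x - x0)) has_derivative (\<lambda>v. t *\<^sub>R v)) (at x within S)"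
          by (auto intro!: derivative_eq_intros)
        have "((\<lambda>x. c t * H (x0 + t *\<^sub>R (x - x0))) has_derivative
          (\<lambda>v. c t * blinfun_apply (J (x0 + t *\<^sub>R (x - x0))) (t *\<^sub>R v))) (at x within S)"
          by (intro has_derivative_mult_right has_derivative_compose[OF g HJ]) (use x t mem in simp)
        then show "((\<lambda>x. c t * H (x0 + t *\<^sub>R (x - x0))) has_derivative blinfun_apply (fx x t)) (at x within S)"
          by (rule has_derivative_eq_rhs) (simp add: fx_def fun_eq_iff blinfun.scaleR_left blinfun.scaleR_right)
      next
        fix x assume "x \<in> S"
        have "continuous_on S H" using Suc.prems(2) by (rule ck_on_imp_continuous)
        then have "continuous_on (cbox 0 1) (\<lambda>t. c t * H (x0 + t *\<^sub>R (x - x0)))"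
          using continuous_on_compose2[OF cont[OF Suc.prems(1)] Pair_cont[of x], of H] \<open>x \<in> S\<close>
          by (simp add: image_subset_iff)
        then show "(\<lambda>t. c t * H (x0 + t *\<^sub>R (x - x0))) integrable_on cbox 0 1"
          by (rule integrable_continuous)
      qed
      then show ?thesis unfolding at_within_open[OF y assms(1)] cbox_interval .
    qed
    show ?case
    proof (rule ck_on_SucI[OF assms(1) der])
      fix v
      have "ck_on k S (\<lambda>x. integral {0..1} (\<lambda>t. (c t * t) * frechet_derivative H (at (x0 + t *\<^sub>R (x - x0))) v))"
        by (rule Suc.IH) (use Suc.prems in \<open>auto intro!: continuous_on_mult continuous_on_id\<close>)
      then show "ck_on k S (\<lambda>x. blinfun_apply (integral {0..1} (fx x)) v)"
      proof (rule ck_on_cong[OF assms(1), rotated])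
        fix x assume x: "x \<in> S"
        show "integral {0..1} (\<lambda>t. (c t * t) * frechet_derivative H (at (x0 + t *\<^sub>R (x - x0))) v) =
          blinfun_apply (integral {0..1} (fx x)) v"
          unfolding blinfun_apply_integral[OF int[OF x]]
          by (rule integral_cong) (use mem x in \<open>simp add: fx_def J blinfun.scaleR_left blinfun.scaleR_right\<close>)
      qed
    qed
  }
qed

text \<open>Integrate the derivative of \<open>h\<close> along the segment from \<open>x0\<close> to
  \<open>x\<close>: \<open>g b\<close> is the average over that segment of the partial derivative in
  direction \<open>b\<close>.\<close>

lemma hadamard:
  fixes h :: "'e::euclidean_space \<Rightarrow> real"
  assumes S: "open S" "convex S" "x0 \<in> S" and h: "smooth_on S h"
  obtains g where "\<And>b. smooth_on S (g b)" "\<And>b. g b x0 = frechet_derivative h (at x0) b"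
    "\<And>x. x \<in> S \<Longrightarrow> h x = h x0 + (\<Sum>b\<in>Basis. ((x - x0) \<bullet> b) * g b x)"
proof
  let ?h' = "\<lambda>x. frechet_derivative h (at x)"
  define g where "g = (\<lambda>b x. integral {0..1::real} (\<lambda>t. 1 * ?h' (x0 + t *\<^sub>R (x - x0)) b))"
  show "smooth_on S (g b)" for b
    unfolding g_def smooth_on_def
    using smooth_on_derivative[OF h, of b] ck_on_radial_integral[OF S, of "\<lambda>_. 1"]
    by (auto simp: smooth_on_def)
  show "g b x0 = ?h' x0 b" for b by (simp add: g_def)
  fix x assume x: "x \<in> S"
  have mem: "x0 + t *\<^sub>R (x - x0) \<in> S" if "t \<in> {0..1}" for t
  proof -
    have "(1 - t) *\<^sub>R x0 + t *\<^sub>R x \<in> S" using that S x by (intro convexD) auto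
    then show ?thesis by (simp add: algebra_simps)
  qed
  have int: "(\<lambda>t. ?h' (x0 + t *\<^sub>R (x - x0)) b) integrable_on {0..1}" for b
    by (intro integrable_continuous_interval
        continuous_on_compose2[OF smooth_on_imp_continuous[OF smooth_on_derivative[OF h, of b]]]
        continuous_intros) (use mem in auto)
  have "((\<lambda>t. ?h' (x0 + t *\<^sub>R (x - x0)) (x - x0)) has_integral
     h (x0 + 1 *\<^sub>R (x - x0)) - h (x0 + 0 *\<^sub>R (x - x0))) {0..1}"
  proof (rule fundamental_theorem_of_calculus)
    fix t :: real assume t: "t \<in> {0..1}"
    have g: "((\<lambda>t. x0 + t *\<^sub>R (x - x0)) has_derivative (\<lambda>s. s *\<^sub>R (x - x0))) (at t within {0..1})"
      by (auto intro!: derivative_eq_intros)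
    note H = smooth_on_has_derivative[OF h mem[OF t]]
    show "((\<lambda>t. h (x0 + t *\<^sub>R (x - x0))) has_vector_derivative
       ?h' (x0 + t *\<^sub>R (x - x0)) (x - x0)) (at t within {0..1})"
      using has_derivative_compose[OF g H]
      by (simp add: has_vector_derivative_def linear_scale[OF has_derivative_linear[OF H]])
  qed simp
  from integral_unique[OF this]
  have "h x = h x0 + integral {0..1} (\<lambda>t. ?h' (x0 + t *\<^sub>R (x - x0)) (x - x0))"
    by simp
  also have "integral {0..1} (\<lambda>t. ?h' (x0 + t *\<^sub>R (x - x0)) (x - x0)) =
     integral {0..1} (\<lambda>t. \<Sum>b\<in>Basis. ((x - x0) \<bullet> b) * ?h' (x0 + t *\<^sub>R (x - x0)) b)"
  proof (rule integral_cong)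
    fix t :: real assume t: "t \<in> {0..1}"
    note L = has_derivative_linear[OF smooth_on_has_derivative[OF h mem[OF t]]]
    have "?h' (x0 + t *\<^sub>R (x - x0)) (x - x0) =
      ?h' (x0 + t *\<^sub>R (x - x0)) (\<Sum>b\<in>Basis. ((x - x0) \<bullet> b) *\<^sub>R b)"
      by (simp add: euclidean_representation)
    also have "\<dots> = (\<Sum>b\<in>Basis. ((x - x0) \<bullet> b) * ?h' (x0 + t *\<^sub>R (x - x0)) b)"
      by (simp only: linear_sum[OF L] linear_scale[OF L] real_scaleR_def)
    finally show "?h' (x0 + t *\<^sub>R (x - x0)) (x - x0) =
      (\<Sum>b\<in>Basis. ((x - x0) \<bullet> b) * ?h' (x0 + t *\<^sub>R (x - x0)) b)" .
  qed
  also have "\<dots> = (\<Sum>b\<in>Basis. ((x - x0) \<bullet> b) * g b x)"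
    by (subst integral_sum) (simp_all add: g_def integrable_on_mult_right int)
  finally show "h x = h x0 + (\<Sum>b\<in>Basis. ((x - x0) \<bullet> b) * g b x)" .
qed

section \<open>Symplectic Lie algebras\<close>

text \<open>\<open>F\<close> is the \<open>w\<close>-dual family of \<open>B\<close>, so
  \<open>w x (F b)\<close> is the coordinate of \<open>x\<close> at \<open>b\<close>;
  \<open>expand\<close> carries both spanning and nondegeneracy. Coordinates are phrased through
  \<open>w\<close> because on the manifold the same pairings, taken for arbitrary vector fields, are
  smooth functions. \<open>V\<close> is a subset since it will be the Lie algebra inside the space
  of all maps on functions.\<close>

locale symplectic_vector_space =
  fixes V :: "'v::real_vector set" and w :: "'v \<Rightarrow> 'v \<Rightarrow> real" and B :: "'v set" and F :: "'v \<Rightarrow> 'v"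
  assumes subspace_V: "subspace V"
    and finite_B: "finite B" and B_sub: "B \<subseteq> V" and F_in: "b \<in> B \<Longrightarrow> F b \<in> V"
    and w_add: "\<lbrakk>x \<in> V; y \<in> V; z \<in> V\<rbrakk> \<Longrightarrow> w (x + y) z = w x z + w y z"
    and w_scale: "\<lbrakk>x \<in> V; z \<in> V\<rbrakk> \<Longrightarrow> w (c *\<^sub>R x) z = c * w x z"
    and w_skew: "\<lbrakk>x \<in> V; y \<in> V\<rbrakk> \<Longrightarrow> w x y = - w y x"
    and expand: "x \<in> V \<Longrightarrow> x = (\<Sum>b\<in>B. w x (F b) *\<^sub>R b)"
    and dual: "\<lbrakk>b \<in> B; b' \<in> B\<rbrakk> \<Longrightarrow> w b (F b') = (if b = b' then 1 else 0)"
begin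

section \<open>Dual bases, linear maps and traces\<close>

lemma B_in [simp]: "b \<in> B \<Longrightarrow> b \<in> V" using B_sub by auto

lemmas V_intros [simp] = F_in subspace_add[OF subspace_V] subspace_diff[OF subspace_V]
  subspace_neg[OF subspace_V] subspace_scale[OF subspace_V] subspace_0[OF subspace_V]
  subspace_sum[OF subspace_V]

lemma w_add_right: "\<lbrakk>x \<in> V; y \<in> V; z \<in> V\<rbrakk> \<Longrightarrow> w z (x + y) = w z x + w z y"
  using w_skew[of z "x + y"] w_skew[of z x] w_skew[of z y] by (simp add: w_add)

lemma w_scale_right: "\<lbrakk>x \<in> V; z \<in> V\<rbrakk> \<Longrightarrow> w z (c *\<^sub>R x) = c * w z x"
  using w_skew[of z "c *\<^sub>R x"] w_skew[of z x] by (simp add: w_scale)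

lemma w_minus: "\<lbrakk>x \<in> V; z \<in> V\<rbrakk> \<Longrightarrow> w (- x) z = - w x z"
  using w_scale[of x z "-1"] by simp

lemma w_minus_right: "\<lbrakk>x \<in> V; z \<in> V\<rbrakk> \<Longrightarrow> w z (- x) = - w z x"
  using w_scale_right[of x z "-1"] by simp

lemma w_diff: "\<lbrakk>x \<in> V; y \<in> V; z \<in> V\<rbrakk> \<Longrightarrow> w (x - y) z = w x z - w y z"
  using w_add[of x "- y" z] by (simp add: w_minus)

lemma w_diff_right: "\<lbrakk>x \<in> V; y \<in> V; z \<in> V\<rbrakk> \<Longrightarrow> w z (x - y) = w z x - w z y"
  using w_add_right[of x "- y" z] by (simp add: w_minus_right)

lemmas w_simps = w_add w_add_right w_scale w_scale_right w_minus w_minus_right w_diff w_diff_right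

lemma w_sum: "(\<And>i. i \<in> I \<Longrightarrow> f i \<in> V) \<Longrightarrow> z \<in> V \<Longrightarrow> w (\<Sum>i\<in>I. c i *\<^sub>R f i) z = (\<Sum>i\<in>I. c i * w (f i) z)"
proof (induction I rule: infinite_finite_induct)
  case (infinite A)
  then show ?case using w_scale[of 0 z 0] by simp
next
  case empty
  then show ?case using w_scale[of 0 z 0] by simp
qed (simp add: w_add w_scale)

lemma w_sum_right: "(\<And>i. i \<in> I \<Longrightarrow> f i \<in> V) \<Longrightarrow> z \<in> V \<Longrightarrow> w z (\<Sum>i\<in>I. c i *\<^sub>R f i) = (\<Sum>i\<in>I. c i * w z (f i))"
proof (induction I rule: infinite_finite_induct)
  case (infinite A)
  then show ?case using w_scale_right[of 0 z 0] by simp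
next
  case empty
  then show ?case using w_scale_right[of 0 z 0] by simp
qed (simp add: w_add_right w_scale_right)

lemma w_eqI: "\<lbrakk>x \<in> V; y \<in> V; \<And>z. z \<in> V \<Longrightarrow> w x z = w y z\<rbrakk> \<Longrightarrow> x = y"
  using expand[of x] expand[of y] by simp

lemma w_expand:
  assumes "x \<in> V" "y \<in> V"
  shows "w x y = (\<Sum>b\<in>B. w x (F b) * w b y)"
  by (subst expand[OF assms(1)]) (simp add: w_sum assms)

text \<open>\<open>F\<close> is a basis too, with coordinates \<open>w b x\<close>: both sides pair
  equally with each element of \<open>B\<close>, hence with all of \<open>V\<close>.\<close>

lemma expand_dual:
  assumes "x \<in> V"
  shows "x = (\<Sum>b\<in>B. w b x *\<^sub>R F b)"
proof -
  let ?y = "\<Sum>b\<in>B. w b x *\<^sub>R F b"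
  have y: "?y \<in> V" by simp
  have "w c x = w c ?y" if "c \<in> B" for c
    using that by (simp add: w_sum_right dual if_distrib finite_B sum.delta' cong: if_cong)
  then have "w z x = w z ?y" if "z \<in> V" for z
    using w_expand[OF that assms] w_expand[OF that y] by simp
  then show ?thesis using w_eqI[OF assms y] w_skew assms y by metis
qed

text \<open>Linearity is asked on \<open>V\<close> only, because brackets with arbitrary maps on
  functions need not be linear.\<close>

definition lin :: "('v \<Rightarrow> 'v) \<Rightarrow> bool" where
  "lin T \<longleftrightarrow> (\<forall>x\<in>V. T x \<in> V \<and> (\<forall>c. T (c *\<^sub>R x) = c *\<^sub>R T x) \<and> (\<forall>y\<in>V. T (x + y) = T x + T y))"

lemma lin_in [simp]: "lin T \<Longrightarrow> x \<in> V \<Longrightarrow> T x \<in> V"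
  by (simp add: lin_def)

lemma lin_sum:
  assumes "lin T" "\<And>i. i \<in> I \<Longrightarrow> f i \<in> V"
  shows "T (\<Sum>i\<in>I. c i *\<^sub>R f i) = (\<Sum>i\<in>I. c i *\<^sub>R T (f i))"
proof -
  have T0: "T 0 = 0" using assms(1) unfolding lin_def using subspace_0[OF subspace_V] by (metis scale_zero_left)
  show ?thesis
    using assms(2)
    by (induction I rule: infinite_finite_induct) (use assms(1) T0 in \<open>auto simp: lin_def\<close>)
qed

lemma lin_minus:
  assumes "lin T" "x \<in> V" "y \<in> V"
  shows "T (x - y) = T x - T y"
  using assms(1)[unfolded lin_def, rule_format, of "x - y"] assms(2,3) by force

lemma lin_compose: "lin S \<Longrightarrow> lin T \<Longrightarrow> lin (\<lambda>x. S (T x))"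
  by (simp add: lin_def)

lemma lin_add: "lin S \<Longrightarrow> lin T \<Longrightarrow> lin (\<lambda>x. S x + T x)"
  by (simp add: lin_def algebra_simps)

lemma lin_diff: "lin S \<Longrightarrow> lin T \<Longrightarrow> lin (\<lambda>x. S x - T x)"
  by (simp add: lin_def algebra_simps)

lemma lin_scale: "lin S \<Longrightarrow> lin (\<lambda>x. c *\<^sub>R S x)"
  by (simp add: lin_def algebra_simps)

lemma lin_expand:
  assumes "lin T" "x \<in> V"
  shows "T x = (\<Sum>b\<in>B. w x (F b) *\<^sub>R T b)"
  by (subst expand[OF assms(2)], rule lin_sum[OF assms(1)]) simp

definition tr :: "('v \<Rightarrow> 'v) \<Rightarrow> real" where
  "tr T = (\<Sum>b\<in>B. w (T b) (F b))"

lemma tr_cong: "(\<And>x. x \<in> V \<Longrightarrow> S x = T x) \<Longrightarrow> tr S = tr T"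
  unfolding tr_def by (rule sum.cong) auto

lemma tr_add: "lin S \<Longrightarrow> lin T \<Longrightarrow> tr (\<lambda>x. S x + T x) = tr S + tr T"
  by (simp add: tr_def w_add sum.distrib)

lemma tr_diff: "lin S \<Longrightarrow> lin T \<Longrightarrow> tr (\<lambda>x. S x - T x) = tr S - tr T"
  by (simp add: tr_def w_diff sum_subtractf)

lemma tr_scale: "lin S \<Longrightarrow> tr (\<lambda>x. c *\<^sub>R S x) = c * tr S"
  by (simp add: tr_def w_scale sum_distrib_left)

lemma tr_comm:
  assumes "lin S" "lin T"
  shows "tr (\<lambda>x. S (T x)) = tr (\<lambda>x. T (S x))"
proof -
  have *: "tr (\<lambda>x. S (T x)) = (\<Sum>b\<in>B. \<Sum>c\<in>B. w (T b) (F c) * w (S c) (F b))"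
    if "lin S" "lin T" for S T
    unfolding tr_def
  proof (rule sum.cong)
    fix b assume b: "b \<in> B"
    have "S (T b) = (\<Sum>c\<in>B. w (T b) (F c) *\<^sub>R S c)"
      using that b by (intro lin_expand) simp_all
    then show "w (S (T b)) (F b) = (\<Sum>c\<in>B. w (T b) (F c) * w (S c) (F b))"
      using that b by (simp add: w_sum)
  qed simp
  show ?thesis
    unfolding *[OF assms] *[OF assms(2,1)] by (subst sum.swap) (simp add: mult.commute)
qed

text \<open>The left side is the trace of the \<open>w\<close>-adjoint of \<open>T\<close>, so this
  says that an operator and its adjoint have the same trace. Expanding \<open>F b\<close> in
  \<open>B\<close> and summing over \<open>b\<close> first reassembles \<open>T c\<close> by
  \<open>expand_dual\<close>.\<close>

lemma tr_adjoint:
  assumes "lin T"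
  shows "(\<Sum>b\<in>B. w b (T (F b))) = tr T"
proof -
  have "w b (T (F b)) = (\<Sum>c\<in>B. w (F b) (F c) * w b (T c))" if b: "b \<in> B" for b
  proof -
    have "T (F b) = (\<Sum>c\<in>B. w (F b) (F c) *\<^sub>R T c)"
      using assms b by (intro lin_expand) simp_all
    then show ?thesis using assms b by (simp add: w_sum_right)
  qed
  then have "(\<Sum>b\<in>B. w b (T (F b))) = (\<Sum>b\<in>B. \<Sum>c\<in>B. w b (T c) * w (F b) (F c))"
    by (simp add: mult.commute)
  also have "\<dots> = (\<Sum>c\<in>B. w (\<Sum>b\<in>B. w b (T c) *\<^sub>R F b) (F c))"
    by (subst sum.swap) (simp add: w_sum assms)
  also have "\<dots> = tr T"
    unfolding tr_def using expand_dual[symmetric] assms by (intro sum.cong) auto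
  finally show ?thesis .
qed

end

section \<open>The left-symmetric product and its symplectic projection\<close>

locale symplectic_lie_algebra = symplectic_vector_space +
  fixes br :: "'a \<Rightarrow> 'a \<Rightarrow> 'a"
  assumes br_in [simp]: "\<lbrakk>x \<in> V; y \<in> V\<rbrakk> \<Longrightarrow> br x y \<in> V"
    and br_add: "\<lbrakk>x \<in> V; y \<in> V; z \<in> V\<rbrakk> \<Longrightarrow> br x (y + z) = br x y + br x z"
    and br_scale: "\<lbrakk>x \<in> V; y \<in> V\<rbrakk> \<Longrightarrow> br x (c *\<^sub>R y) = c *\<^sub>R br x y"
    and br_skew: "\<lbrakk>x \<in> V; y \<in> V\<rbrakk> \<Longrightarrow> br x y = - br y x"
    and jacobi: "\<lbrakk>x \<in> V; y \<in> V; z \<in> V\<rbrakk> \<Longrightarrow> br (br x y) z = br x (br y z) - br y (br x z)"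
    and closed: "\<lbrakk>x \<in> V; y \<in> V; z \<in> V\<rbrakk> \<Longrightarrow> w (br x y) z + w (br y z) x + w (br z x) y = 0"
begin

lemma lin_br: "x \<in> V \<Longrightarrow> lin (br x)"
  by (simp add: lin_def br_add br_scale)

lemma lin_br_left:
  assumes x: "x \<in> V"
  shows "lin (\<lambda>z. br z x)"
proof -
  have "br (c *\<^sub>R y) x = c *\<^sub>R br y x" if "y \<in> V" for c y
    using br_skew[OF that x] br_skew[of "c *\<^sub>R y" x] x that by (simp add: br_scale)
  moreover have "br (y + z) x = br y x + br z x" if "y \<in> V" "z \<in> V" for y z
    using br_skew[OF that(1) x] br_skew[OF that(2) x] br_skew[of "y + z" x] x that
    by (simp add: br_add)
  ultimately show ?thesis using x by (simp add: lin_def)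
qed

text \<open>
  The left-symmetric product of a symplectic Lie algebra: left multiplication by \<open>x\<close> is minus the
  \<open>w\<close>-adjoint of \<open>br x\<close>.
\<close>

definition dot :: "'a \<Rightarrow> 'a \<Rightarrow> 'a" where
  "dot x y = - (\<Sum>b\<in>B. w y (br x (F b)) *\<^sub>R b)"

lemma dot_in [simp]: "dot x y \<in> V"
  by (simp add: dot_def)

lemma w_dot:
  assumes "x \<in> V" "y \<in> V" "z \<in> V"
  shows "w (dot x y) z = - w y (br x z)"
proof -
  have "w y (br x z) = w y (br x (\<Sum>b\<in>B. w b z *\<^sub>R F b))"
    by (rule arg_cong[OF expand_dual[OF assms(3)], of "\<lambda>u. w y (br x u)"])
  also have "\<dots> = (\<Sum>b\<in>B. w b z * w y (br x (F b)))"
    using assms by (simp add: lin_sum[OF lin_br] w_sum_right)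
  finally show ?thesis
    using assms by (simp add: dot_def w_minus w_sum mult.commute)
qed

lemma lin_dot: "x \<in> V \<Longrightarrow> lin (dot x)"
  unfolding lin_def by (auto intro!: w_eqI simp: w_dot w_simps)

lemma lin_dot_left: "x \<in> V \<Longrightarrow> lin (\<lambda>z. dot z x)"
proof -
  assume x: "x \<in> V"
  have "br (y + z) u = br y u + br z u" "br (c *\<^sub>R y) u = c *\<^sub>R br y u"
    if "y \<in> V" "z \<in> V" "u \<in> V" for y z u c
    using lin_br_left[OF that(3)] that by (simp_all add: lin_def)
  then show ?thesis
    unfolding lin_def using x by (auto intro!: w_eqI simp: w_dot w_simps)
qed

text \<open>Paired with \<open>z\<close> this is the cocycle identity \<open>closed\<close>:
  closedness of the form is torsion-freeness of \<open>dot\<close>.\<close>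

lemma dot_commutator:
  assumes "x \<in> V" "y \<in> V"
  shows "dot x y - dot y x = br x y"
proof (rule w_eqI)
  fix z assume z: "z \<in> V"
  have "w (br x y) z = w x (br y z) - w y (br x z)"
    using closed[OF assms z] w_skew[of "br y z" x] w_skew[of "br z x" y] br_skew[of z x] assms z
    by (simp add: w_minus_right)
  then show "w (dot x y - dot y x) z = w (br x y) z"
    using assms z by (simp add: w_diff w_dot)
qed (use assms in auto)

text \<open>Passing to minus the adjoint turns a representation into a representation, and by Jacobi
  \<open>br\<close> is one. Together with \<open>dot_commutator\<close> this is
  left-symmetry.\<close>

lemma dot_flat:
  assumes "x \<in> V" "y \<in> V" "z \<in> V"
  shows "dot (br x y) z = dot x (dot y z) - dot y (dot x z)"
proof (rule w_eqI)
  fix u assume "u \<in> V"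
  then show "w (dot (br x y) z) u = w (dot x (dot y z) - dot y (dot x z)) u"
    using assms by (simp add: w_diff w_dot jacobi w_diff_right)
qed (use assms in auto)

lemma tr_dot:
  assumes "x \<in> V"
  shows "tr (dot x) = - tr (br x)"
  by (subst tr_adjoint[OF lin_br[OF assms], symmetric]) (simp add: tr_def w_dot sum_negf assms)

text \<open>The two signs cancel and adjoints reverse the order, so \<open>dot x\<close> after
  \<open>dot y\<close> is the adjoint of \<open>br y\<close> after \<open>br x\<close>.\<close>

lemma tr_dot_dot:
  assumes "x \<in> V" "y \<in> V"
  shows "tr (\<lambda>z. dot x (dot y z)) = tr (\<lambda>z. br y (br x z))"
  unfolding tr_adjoint[OF lin_compose[OF lin_br lin_br, OF assms(2,1)], symmetric] tr_def
  using assms by (simp add: w_dot)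

text \<open>The symplectic torsion-free projection of the flat connection given by \<^const>\<open>dot\<close>.\<close>

definition con :: "'a \<Rightarrow> 'a \<Rightarrow> 'a" where
  "con x y = (1/3) *\<^sub>R (br x y + dot x y)"

lemma con_in [simp]: "x \<in> V \<Longrightarrow> y \<in> V \<Longrightarrow> con x y \<in> V"
  by (simp add: con_def)

lemma lin_con: "x \<in> V \<Longrightarrow> lin (con x)"
  unfolding con_def by (intro lin_scale lin_add lin_br lin_dot)

lemma lin_con_left: "x \<in> V \<Longrightarrow> lin (\<lambda>z. con z x)"
  unfolding con_def by (intro lin_scale lin_add lin_br_left lin_dot_left)

text \<open>The bracket part contributes \<open>br x y\<close> twice and, by
  \<open>dot_commutator\<close>, the \<open>dot\<close> part once more; the factor 1/3 is exactly
  what compensates.\<close>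

lemma con_torsion_free:
  assumes "x \<in> V" "y \<in> V"
  shows "con x y - con y x = br x y"
proof -
  have "con x y - con y x = (1/3) *\<^sub>R (br x y - br y x + (dot x y - dot y x))"
    by (simp add: con_def algebra_simps)
  also have "\<dots> = (1/3) *\<^sub>R (3 *\<^sub>R br x y)"
    using br_skew[OF assms(2,1)] dot_commutator[OF assms] scaleR_left_distrib[of 1 2 "br x y"]
    by (simp add: scaleR_2)
  finally show ?thesis by simp
qed

text \<open>\<open>br x + dot x\<close> is \<open>br x\<close> minus its \<open>w\<close>-adjoint,
  hence infinitesimally symplectic, whatever the scalar in front.\<close>

lemma con_symplectic:
  assumes "x \<in> V" "y \<in> V" "z \<in> V"
  shows "w (con x y) z + w y (con x z) = 0"
  using assms w_dot[of x z y] w_skew[of y "dot x z"] w_skew[of z "br x y"]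
  by (simp add: con_def w_simps w_dot diff_divide_distrib)

text \<open>Nilpotency enters through the two trace hypotheses alone: unimodularity and a vanishing
  Killing form.\<close>

lemma con_ricci_flat:
  assumes unimodular: "\<And>x. x \<in> V \<Longrightarrow> tr (br x) = 0"
    and killing: "\<And>x y. x \<in> V \<Longrightarrow> y \<in> V \<Longrightarrow> tr (\<lambda>z. br x (br y z)) = 0"
    and xy: "x \<in> V" "y \<in> V"
  shows "tr (\<lambda>z. con x (con z y) - con z (con x y) - con (br x z) y) = 0"
proof -
  define r where "r = (\<lambda>y z. con z y)"
  have lin_r: "lin (r y)" if "y \<in> V" for y unfolding r_def by (rule lin_con_left[OF that])
  \<comment> \<open>\<open>dot_commutator\<close> trades right multiplication by \<open>y\<close>
    for left multiplication by \<open>y\<close>, so the traces reduce to those of \<open>br\<close>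
    by adjunction.\<close>
  have r_eq: "r y z = (1/3) *\<^sub>R (dot y z - 2 *\<^sub>R br y z)" if "y \<in> V" "z \<in> V" for y z
  proof -
    have "dot z y = dot y z - br y z" using dot_commutator[OF that] by (simp add: algebra_simps)
    then show ?thesis using br_skew[OF that] by (simp add: r_def con_def algebra_simps scaleR_2)
  qed
  have tr_r: "tr (r y) = 0" if "y \<in> V" for y
  proof -
    have "tr (r y) = tr (\<lambda>z. (1/3) *\<^sub>R (dot y z - 2 *\<^sub>R br y z))"
      by (rule tr_cong) (rule r_eq[OF that])
    then show ?thesis
      using that by (simp add: tr_scale tr_diff lin_diff lin_dot lin_br lin_scale unimodular tr_dot)
  qed
  note lins = lin_br lin_dot lin_diff lin_scale lin_r lin_con
    lin_compose[OF lin_dot lin_dot] lin_compose[OF lin_dot lin_br] lin_compose[OF lin_br lin_dot]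
    lin_compose[OF lin_br lin_br] lin_compose[OF lin_con lin_r] lin_compose[OF lin_r lin_br]
    lin_compose[OF lin_r lin_r] lin_compose[OF lin_br lin_r]
  \<comment> \<open>Let \<open>R y\<close> be right multiplication for \<open>dot\<close>.
    Left-symmetry gives \<open>R x\<close> after \<open>R y\<close> as \<open>R (dot y x)\<close>
    minus the commutator of \<open>dot y\<close> and \<open>R x\<close>, so its trace vanishes.
    Substituting \<open>R y = dot y - br y\<close> and discarding the pure products, whose traces
    vanish by \<open>killing\<close> and \<open>tr_dot_dot\<close>, leaves minus the mixed
    sum.\<close>
  have cross: "tr (\<lambda>z. dot x (br y z)) + tr (\<lambda>z. br x (dot y z)) = 0" if x: "x \<in> V" and y: "y \<in> V" for x y
  proof -
    define R where "R = (\<lambda>y z. dot z y)"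
    have lin_R: "lin (R y)" if "y \<in> V" for y unfolding R_def by (rule lin_dot_left[OF that])
    have R_eq: "R y z = dot y z - br y z" if "y \<in> V" "z \<in> V" for y z
      using dot_commutator[OF that] by (simp add: R_def algebra_simps)
    have tr_R: "tr (R y) = 0" if "y \<in> V" for y
      using tr_cong[of "R y", OF R_eq[OF that]] that
      by (simp add: tr_diff lin_dot lin_br unimodular tr_dot)
    have "R x (R y z) = R (dot y x) z - (dot y (R x z) - R x (dot y z))" if z: "z \<in> V" for z
    proof -
      have "dot (dot z y) x - dot (dot y z) x = dot z (dot y x) - dot y (dot z x)"
        using dot_flat[OF z y x] lin_minus[OF lin_dot_left[OF x], of "dot z y" "dot y z"]
        by (simp add: dot_commutator[OF z y])
      then show ?thesis by (simp add: R_def algebra_simps)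
    qed
    then have "tr (\<lambda>z. R x (R y z)) = tr (\<lambda>z. R (dot y x) z - (dot y (R x z) - R x (dot y z)))"
      by (rule tr_cong)
    also have "\<dots> = 0"
      using tr_comm[OF lin_dot lin_R, of y x] x y by (simp add: tr_diff lins lin_R tr_R lin_compose[OF lin_dot lin_R] lin_compose[OF lin_R lin_dot])
    finally have "tr (\<lambda>z. R x (R y z)) = 0" .
    moreover have "tr (\<lambda>z. R x (R y z)) = tr (\<lambda>z. dot x (dot y z) - dot x (br y z) - (br x (dot y z) - br x (br y z)))"
      by (rule tr_cong) (use x y in \<open>simp add: R_eq lin_minus[OF lin_dot] lin_minus[OF lin_br]\<close>)
    ultimately show ?thesis
      using x y by (simp add: tr_diff lins tr_dot_dot killing)
  qed
  \<comment> \<open>Torsion-freeness of \<open>con\<close>: the summand \<open>br x\<close> produces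
    a trace that will cancel against the curvature term with \<open>br x z\<close>.\<close>
  have con_r: "con x z = r x z + br x z" if "z \<in> V" for z
    using con_torsion_free[OF xy(1) that] by (simp add: r_def algebra_simps)
  have "tr (\<lambda>z. con x (con z y) - con z (con x y) - con (br x z) y) =
    tr (\<lambda>z. con x (r y z) - r (con x y) z - r y (br x z))"
    by (simp add: r_def)
  also have "\<dots> = tr (\<lambda>z. con x (r y z)) - tr (\<lambda>z. r y (br x z))"
    using xy by (simp add: tr_diff lins tr_r)
  also have "tr (\<lambda>z. con x (r y z)) = tr (\<lambda>z. r x (r y z) + br x (r y z))"
    by (rule tr_cong) (use xy con_r lin_r in simp)
  also have "\<dots> = tr (\<lambda>z. r x (r y z)) + tr (\<lambda>z. br x (r y z))"
    using xy by (simp add: tr_add lins)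
  also have "tr (\<lambda>z. br x (r y z)) = tr (\<lambda>z. r y (br x z))"
    using tr_comm[OF lin_br lin_r] xy by blast
  also have "tr (\<lambda>z. r x (r y z)) = tr (\<lambda>z. (1/9) *\<^sub>R ((dot x (dot y z) - 2 *\<^sub>R dot x (br y z))
     - 2 *\<^sub>R (br x (dot y z) - 2 *\<^sub>R br x (br y z))))"
  proof (rule tr_cong)
    fix z assume z: "z \<in> V"
    have "br x (r y z) = (1/3) *\<^sub>R (br x (dot y z) - 2 *\<^sub>R br x (br y z))"
      "dot x (r y z) = (1/3) *\<^sub>R (dot x (dot y z) - 2 *\<^sub>R dot x (br y z))"
      using xy z lin_dot[OF xy(1)] lin_br[OF xy(1)]
      by (simp_all add: r_eq lin_minus[OF lin_dot] lin_minus[OF lin_br] lin_def)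
    then show "r x (r y z) = (1/9) *\<^sub>R ((dot x (dot y z) - 2 *\<^sub>R dot x (br y z))
       - 2 *\<^sub>R (br x (dot y z) - 2 *\<^sub>R br x (br y z)))"
      using r_eq[OF xy(1) lin_in[OF lin_r[OF xy(2)] z]] by (simp add: scaleR_diff_right)
  qed
  also have "\<dots> = 0"
    using cross[OF xy] xy by (simp add: tr_scale tr_diff lins tr_dot_dot killing)
  finally show ?thesis by simp
qed

end

section \<open>Traces and dual bases\<close>

lemma sum_fun_apply: "(\<Sum>i\<in>I. f i) x = (\<Sum>i\<in>I. f i x)"
  by (induction I rule: infinite_finite_induct) simp_all

lemma scaleR_fun_apply: "(c *\<^sub>R f) x = c *\<^sub>R f x"
  by (simp add: scaleR_fun_def)

lemma additive_functional_sum: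
  fixes \<alpha> :: "'v::real_vector \<Rightarrow> real"
  assumes V: "subspace V"
    and add: "\<And>x y. x \<in> V \<Longrightarrow> y \<in> V \<Longrightarrow> \<alpha> (x + y) = \<alpha> x + \<alpha> y"
    and scale: "\<And>c x. x \<in> V \<Longrightarrow> \<alpha> (c *\<^sub>R x) = c * \<alpha> x"
    and f: "\<And>i. i \<in> I \<Longrightarrow> f i \<in> V"
  shows "\<alpha> (\<Sum>i\<in>I. c i *\<^sub>R f i) = (\<Sum>i\<in>I. c i * \<alpha> (f i))"
proof -
  have \<alpha>0: "\<alpha> 0 = 0" using scale[of 0 0] subspace_0[OF V] by simp
  show ?thesis using f
    by (induction I rule: infinite_finite_induct)
      (simp_all add: \<alpha>0 add scale subspace_sum[OF V] subspace_scale[OF V])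
qed

text \<open>This is basis independence in usable form: the family \<open>v\<close> has no relation
  to \<open>B\<close>. It links the basis chosen in \<open>trace_on\<close>, a basis adapted to a
  filtration, and the sum \<open>tr\<close> over dual families.\<close>

lemma rank_one_trace:
  fixes B :: "'v::real_vector set"
  assumes B: "independent B" "finite B" "span B = V"
    and add: "\<And>i x y. i \<in> I \<Longrightarrow> x \<in> V \<Longrightarrow> y \<in> V \<Longrightarrow> \<alpha> i (x + y) = \<alpha> i x + \<alpha> i y"
    and scale: "\<And>i c x. i \<in> I \<Longrightarrow> x \<in> V \<Longrightarrow> \<alpha> i (c *\<^sub>R x) = c * \<alpha> i x"
    and v: "\<And>i. i \<in> I \<Longrightarrow> v i \<in> V"
    and T: "\<And>u. u \<in> V \<Longrightarrow> T u = (\<Sum>i\<in>I. \<alpha> i u *\<^sub>R v i)"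
  shows "(\<Sum>b\<in>B. representation B (T b) b) = (\<Sum>i\<in>I. \<alpha> i (v i))"
proof -
  have V: "subspace V" using B(3) by auto
  have BV: "B \<subseteq> V" using B(3) span_superset by blast
  have "(\<Sum>b\<in>B. representation B (T b) b) = (\<Sum>b\<in>B. \<Sum>i\<in>I. \<alpha> i b * representation B (v i) b)"
  proof (rule sum.cong)
    fix b assume "b \<in> B"
    then have "T b = (\<Sum>i\<in>I. \<alpha> i b *\<^sub>R v i)" using T BV by auto
    then show "representation B (T b) b = (\<Sum>i\<in>I. \<alpha> i b * representation B (v i) b)"
      using v V B(3) by (simp add: representation_sum[OF B(1)] representation_scale[OF B(1)] subspace_scale)
  qed simp
  also have "\<dots> = (\<Sum>i\<in>I. \<Sum>b\<in>B. representation B (v i) b * \<alpha> i b)"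
    by (subst sum.swap) (simp add: mult.commute)
  also have "\<dots> = (\<Sum>i\<in>I. \<alpha> i (v i))"
  proof (rule sum.cong)
    fix i assume i: "i \<in> I"
    have "\<alpha> i (\<Sum>b\<in>B. representation B (v i) b *\<^sub>R b) = (\<Sum>b\<in>B. representation B (v i) b * \<alpha> i b)"
      by (rule additive_functional_sum[OF V add[OF i] scale[OF i]]) (use BV in auto)
    then show "(\<Sum>b\<in>B. representation B (v i) b * \<alpha> i b) = \<alpha> i (v i)"
      using sum_representation_eq[OF B(1) _ B(2) subset_refl, of "v i"] v[OF i] B(3) by simp
  qed simp
  finally show ?thesis .
qed

text \<open>The finite spanning set makes every basis of \<open>V\<close> finite, in particular the
  one that \<open>trace_on\<close> selects by \<open>SOME\<close>.\<close>

lemma trace_on_rank_one: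
  fixes V :: "'v::real_vector set"
  assumes V: "subspace V" and S: "finite S" "V \<subseteq> span S"
    and add: "\<And>i x y. i \<in> I \<Longrightarrow> x \<in> V \<Longrightarrow> y \<in> V \<Longrightarrow> \<alpha> i (x + y) = \<alpha> i x + \<alpha> i y"
    and scale: "\<And>i c x. i \<in> I \<Longrightarrow> x \<in> V \<Longrightarrow> \<alpha> i (c *\<^sub>R x) = c * \<alpha> i x"
    and v: "\<And>i. i \<in> I \<Longrightarrow> v i \<in> V"
    and T: "\<And>u. u \<in> V \<Longrightarrow> T u = (\<Sum>i\<in>I. \<alpha> i u *\<^sub>R v i)"
  shows "trace_on V T = (\<Sum>i\<in>I. \<alpha> i (v i))"
proof -
  define B where "B = (SOME B. B \<subseteq> V \<and> independent B \<and> span B = V)"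
  obtain B' where "B' \<subseteq> V" "independent B'" "V \<subseteq> span B'" by (rule maximal_independent_subset)
  then have "B' \<subseteq> V \<and> independent B' \<and> span B' = V" using V by (auto dest: span_minimal)
  then have B: "B \<subseteq> V \<and> independent B \<and> span B = V" unfolding B_def by (rule someI)
  moreover have "finite B" using independent_span_bound[OF S(1), of B] B S(2) by auto
  ultimately show ?thesis
    using rank_one_trace[of B V I \<alpha> v T] add scale v T by (simp add: trace_on_def flip: B_def)
qed

text \<open>Extend a basis of \<open>W 1\<close> to one of \<open>W 0\<close>. All images
  \<open>T b\<close> lie in \<open>W 1\<close>, so the added vectors have diagonal entry 0, and the
  old ones are handled by induction on the shifted filtration.\<close>

lemma filtered_nilpotent_basis:
  fixes W :: "nat \<Rightarrow> 'v::real_vector set"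
  assumes S: "finite S" "W 0 \<subseteq> span S"
    and sub: "\<And>i. subspace (W i)" and dec: "\<And>i. W (Suc i) \<subseteq> W i"
    and T: "\<And>i x. x \<in> W i \<Longrightarrow> T x \<in> W (Suc i)" and W0: "W k = {0}"
  obtains B where "finite B" "independent B" "span B = W 0" "(\<Sum>b\<in>B. representation B (T b) b) = 0"
proof -
  have "\<exists>B. finite B \<and> independent B \<and> span B = W 0 \<and> (\<Sum>b\<in>B. representation B (T b) b) = 0"
    using S(2) sub dec T W0
  proof (induction k arbitrary: W)
    case 0
    then show ?case by (intro exI[of _ "{}"]) (auto simp: independent_empty)
  next
    case (Suc k)
    have "\<exists>B. finite B \<and> independent B \<and> span B = W (Suc 0) \<and> (\<Sum>b\<in>B. representation B (T b) b) = 0"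
      by (rule Suc.IH[of "\<lambda>i. W (Suc i)"]) (use Suc.prems in \<open>auto intro: order_trans\<close>)
    then obtain B1 where B1: "finite B1" "independent B1" "span B1 = W (Suc 0)"
      and tr1: "(\<Sum>b\<in>B1. representation B1 (T b) b) = 0" by auto
    have "B1 \<subseteq> W 0" using B1(3) span_superset Suc.prems(3) by blast
    then obtain B where B: "B1 \<subseteq> B" "B \<subseteq> W 0" "independent B" "W 0 \<subseteq> span B"
      using maximal_independent_subset_extend B1(2) by blast
    then have fin: "finite B" using independent_span_bound[OF S(1), of B] Suc.prems(1) by auto
    have rep: "representation B (T b) = representation B1 (T b)" if "b \<in> B" for b
      by (rule representation_extend[OF B(3) _ B(1)]) (use that B(2) B1(3) Suc.prems(4) in auto)
    have "(\<Sum>b\<in>B. representation B (T b) b) = (\<Sum>b\<in>B. representation B1 (T b) b)"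
      using rep by simp
    also have "\<dots> = (\<Sum>b\<in>B1. representation B1 (T b) b)"
      by (rule sum.mono_neutral_right[OF fin B(1)]) (auto dest: representation_ne_zero)
    finally have "(\<Sum>b\<in>B. representation B (T b) b) = 0" using tr1 by simp
    moreover have "span B = W 0" using B(2,4) Suc.prems(2)[of 0] by (auto dest: span_minimal)
    ultimately show ?case using fin B(3) by blast
  qed
  then show ?thesis using that by blast
qed

lemma (in symplectic_vector_space) tr_filtered_nilpotent:
  assumes T: "lin T" and W0: "W 0 = V"
    and "\<And>i. subspace (W i)" "\<And>i. W (Suc i) \<subseteq> W i" "\<And>i x. x \<in> W i \<Longrightarrow> T x \<in> W (Suc i)" "W k = {0}"
  shows "tr T = 0"
proof -
  have "V \<subseteq> span B"
  proof
    fix x assume "x \<in> V"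
    then show "x \<in> span B" by (subst expand) (auto intro: span_sum span_scale span_base)
  qed
  then obtain B' where B': "finite B'" "independent B'" "span B' = W 0"
    and "(\<Sum>b\<in>B'. representation B' (T b) b) = 0"
    using filtered_nilpotent_basis[of B W T k] finite_B assms by metis
  moreover have "(\<Sum>b\<in>B'. representation B' (T b) b) = (\<Sum>b\<in>B. w (T b) (F b))"
    by (rule rank_one_trace[OF B'(2,1,3), where \<alpha> = "\<lambda>b x. w x (F b)"])
      (use T lin_expand in \<open>auto simp: W0 w_simps\<close>)
  ultimately show ?thesis by (simp add: tr_def)
qed

text \<open>Nondegeneracy makes \<open>x \<mapsto> (w b x)\<close> with \<open>b\<close> ranging
  over \<open>B\<close> an injective linear map into the real functions on \<open>B\<close>; by
  dimension it is onto, and \<open>F b\<close> is a preimage of the coordinate vector at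
  \<open>b\<close>.\<close>

lemma symplectic_vector_space_exists:
  fixes V :: "'v::real_vector set"
  assumes V: "subspace V" and S: "finite S" "V \<subseteq> span S"
    and w_add: "\<And>x y z. \<lbrakk>x \<in> V; y \<in> V; z \<in> V\<rbrakk> \<Longrightarrow> w (x + y) z = w x z + w y z"
    and w_scale: "\<And>c x z. \<lbrakk>x \<in> V; z \<in> V\<rbrakk> \<Longrightarrow> w (c *\<^sub>R x) z = c * w x z"
    and w_skew: "\<And>x y. \<lbrakk>x \<in> V; y \<in> V\<rbrakk> \<Longrightarrow> w x y = - w y x"
    and nondeg: "\<And>x. x \<in> V \<Longrightarrow> (\<And>y. y \<in> V \<Longrightarrow> w x y = 0) \<Longrightarrow> x = 0"
  obtains B F where "symplectic_vector_space V w B F"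
proof -
  obtain B where B: "B \<subseteq> V" "independent B" "V \<subseteq> span B" by (rule maximal_independent_subset)
  then have span_B: "span B = V" using V by (auto dest: span_minimal)
  have fin: "finite B" using independent_span_bound[OF S(1), of B] B S(2) by auto
  have rep: "(\<Sum>b\<in>B. representation B x b *\<^sub>R b) = x" if "x \<in> V" for x
    using sum_representation_eq[OF B(2) _ fin subset_refl] span_B that by auto
  have w_sum: "w (\<Sum>b\<in>B. c b *\<^sub>R b) y = (\<Sum>b\<in>B. c b * w b y)" if "y \<in> V" for c y
    by (rule additive_functional_sum[OF V]) (use w_add w_scale that B in auto)
  \<comment> \<open>The target is realised inside the functions from the ambient space to the reals,
    where \<open>\<delta> b\<close> are the coordinate vectors.\<close>
  define \<delta> :: "'v \<Rightarrow> 'v \<Rightarrow> real" where "\<delta> = (\<lambda>b b'. if b' = b then 1 else 0)"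
  define \<Phi> where "\<Phi> = (\<lambda>x. \<Sum>b\<in>B. w b x *\<^sub>R \<delta> b)"
  have \<Phi>_apply: "\<Phi> x b = w b x" if "b \<in> B" for x b
  proof -
    have "\<Phi> x b = (\<Sum>b'\<in>B. w b' x * \<delta> b' b)"
      by (simp add: \<Phi>_def sum_fun_apply scaleR_fun_def)
    also have "\<dots> = w b x" using that fin by (simp add: \<delta>_def if_distrib sum.delta cong: if_cong)
    finally show ?thesis .
  qed
  have w_right: "w b (x + y) = w b x + w b y" "w b (c *\<^sub>R x) = c * w b x"
    if "b \<in> V" "x \<in> V" "y \<in> V" for b x y c
    using w_skew[of b "x + y"] w_skew[of b x] w_skew[of b y] w_skew[of b "c *\<^sub>R x"] w_add[of x y b] w_scale[of x b c]
      that V by (auto simp: subspace_add subspace_scale)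
  \<comment> \<open>\<open>g\<close> is linear everywhere and agrees on \<open>V\<close> with the
    pairing that it replaces; outside \<open>V\<close> nothing is known about
    \<open>w\<close>.\<close>
  obtain g where g: "linear g" "\<And>b. b \<in> B \<Longrightarrow> g b = \<Phi> b"
    using linear_independent_extend[OF B(2), of \<Phi>] by auto
  have g_eq: "g x b = w b x" if x: "x \<in> V" and b: "b \<in> B" for x b
  proof -
    have "g x = g (\<Sum>b'\<in>B. representation B x b' *\<^sub>R b')" using rep[OF x] by simp
    also have "\<dots> = (\<Sum>b'\<in>B. representation B x b' *\<^sub>R g b')"
      by (simp add: linear_sum[OF g(1)] linear_scale[OF g(1)])
    finally have "g x b = (\<Sum>b'\<in>B. representation B x b' *\<^sub>R g b') b" by simp
    also have "\<dots> = (\<Sum>b'\<in>B. representation B x b' * g b' b)"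
      by (simp add: sum_fun_apply scaleR_fun_def)
    also have "\<dots> = (\<Sum>b'\<in>B. representation B x b' * w b b')"
      by (rule sum.cong) (simp_all add: g(2) \<Phi>_apply b)
    also have "\<dots> = - w (\<Sum>b'\<in>B. representation B x b' *\<^sub>R b') b"
    proof -
      have "representation B x b' * w b b' = - (representation B x b' * w b' b)" if "b' \<in> B" for b'
        using w_skew[OF subsetD[OF B(1) b] subsetD[OF B(1) that]] by simp
      then show ?thesis using b B(1) by (subst w_sum) (auto simp flip: sum_negf)
    qed
    also have "\<dots> = w b x" using rep[OF x] w_skew[of b x] b B(1) x by auto
    finally show ?thesis .
  qed
  have "inj_on g (span B)"
  proof (subst linear_injective_on_subspace_0[OF g(1)], simp, safe)
    fix x assume "x \<in> span B" and gx: "g x = 0"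
    then have x: "x \<in> V" by (simp add: span_B)
    have "w y x = 0" if "y \<in> V" for y
    proof -
      have "w y x = (\<Sum>b\<in>B. representation B y b * w b x)"
        using w_sum[OF x, of "representation B y"] rep[OF that] by simp
      then show ?thesis using g_eq[OF x] gx by simp
    qed
    then show "x = 0" using nondeg[OF x] w_skew[OF x] by simp
  qed
  then have ind: "independent (g ` B)" and inj: "inj_on g B"
    using linear_independent_injective_image[OF g(1) B(2)] inj_on_subset span_superset by blast+
  have g_span: "g ` B \<subseteq> span (\<delta> ` B)"
    using g(2) by (auto simp: \<Phi>_def intro!: span_sum span_scale intro: span_base)
  \<comment> \<open>Dimension count: otherwise \<open>card B + 1\<close> independent vectors would
    lie in the span of at most \<open>card B\<close> vectors.\<close>
  have in_span: "\<delta> b \<in> span (g ` B)" if "b \<in> B" for b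
  proof (rule ccontr)
    assume *: "\<delta> b \<notin> span (g ` B)"
    then have "independent (insert (\<delta> b) (g ` B))" using ind by (simp add: independent_insertI)
    then have "card (insert (\<delta> b) (g ` B)) \<le> card (\<delta> ` B)"
      using independent_span_bound[of "\<delta> ` B" "insert (\<delta> b) (g ` B)"] fin g_span
        span_base[OF imageI[OF that], of \<delta>] by simp
    moreover have "\<delta> b \<notin> g ` B" using * span_base[of "\<delta> b" "g ` B"] by blast
    ultimately show False using card_image_le[OF fin, of \<delta>] fin by (simp add: card_image[OF inj])
  qed
  have "\<exists>x. x \<in> V \<and> g x = \<delta> b" if "b \<in> B" for b
    using in_span[OF that] unfolding linear_span_image[OF g(1)] span_B by auto
  then obtain F where F: "\<And>b. b \<in> B \<Longrightarrow> F b \<in> V \<and> g (F b) = \<delta> b" by metis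
  then have dual: "w b (F b') = (if b = b' then 1 else 0)" if "b \<in> B" "b' \<in> B" for b b'
    using g_eq[of "F b'" b] that by (simp add: \<delta>_def)
  have expand: "x = (\<Sum>b\<in>B. w x (F b) *\<^sub>R b)" if x: "x \<in> V" for x
  proof -
    have "w x (F b) = representation B x b" if b: "b \<in> B" for b
      using w_sum[of "F b" "representation B x"] F[OF b] rep[OF x] b fin
      by (simp add: dual if_distrib sum.delta cong: if_cong)
    then show ?thesis using rep[OF x] by simp
  qed
  have "symplectic_vector_space V w B F"
    by unfold_locales (fact V fin B(1) F[THEN conjunct1] w_add w_scale w_skew expand dual)+
  then show ?thesis by (rule that)
qed

section \<open>Derivations on a manifold\<close>

locale smooth_manifold =
  fixes A :: "('a::t2_space, 'e::euclidean_space) atlas"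
  assumes smooth_atlas: "smooth_atlas A"
begin

lemma
  assumes "(U, \<phi>) \<in> A"
  shows open_chart: "open U" and open_chart_image: "open (\<phi> ` U)"
    and chart_homeomorphism: "homeomorphism U (\<phi> ` U) \<phi> (inv_into U \<phi>)"
  using smooth_atlas assms by (auto simp: smooth_atlas_def chart_def)

lemma chart_at:
  obtains U \<phi> where "(U, \<phi>) \<in> A" "p \<in> U"
proof -
  have "p \<in> (\<Union>(U, \<phi>)\<in>A. U)" using smooth_atlas by (simp add: smooth_atlas_def)
  then show ?thesis using that by auto
qed

lemma smooth_transition:
  "(U, \<phi>) \<in> A \<Longrightarrow> (V, \<psi>) \<in> A \<Longrightarrow> smooth_on (\<phi> ` (U \<inter> V)) (\<psi> \<circ> inv_into U \<phi>)"
  using smooth_atlas by (auto simp: smooth_atlas_def)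

lemma chart_inv [simp]: "(U, \<phi>) \<in> A \<Longrightarrow> x \<in> U \<Longrightarrow> inv_into U \<phi> (\<phi> x) = x"
  using chart_homeomorphism by (metis homeomorphism_apply1)

lemma open_chart_image_Int:
  assumes "(U, \<phi>) \<in> A" "open N"
  shows "open (\<phi> ` (U \<inter> N))"
proof -
  have "\<phi> ` (U \<inter> N) = \<phi> ` U \<inter> inv_into U \<phi> -` N"
    using chart_inv[OF assms(1)] by auto
  moreover have "open (\<phi> ` U \<inter> inv_into U \<phi> -` N)"
    using chart_homeomorphism[OF assms(1)] open_chart_image[OF assms(1)] assms(2)
    by (intro continuous_open_preimage) (auto simp: homeomorphism_def)
  ultimately show ?thesis by simp
qed

section \<open>Smooth functions: closure, locality and cutoffs\<close>

lemma smooth_functionsD: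
  "f \<in> smooth_functions A \<Longrightarrow> (U, \<phi>) \<in> A \<Longrightarrow> smooth_on (\<phi> ` U) (\<lambda>x. f (inv_into U \<phi> x))"
  by (auto simp: smooth_functions_def smooth_map_def o_def)

text \<open>The continuity demanded by \<open>smooth_map\<close> is automatic, since near each point
  the function factors through a chart.\<close>

lemma smooth_functionsI:
  assumes "\<And>U \<phi>. (U, \<phi>) \<in> A \<Longrightarrow> smooth_on (\<phi> ` U) (\<lambda>x. f (inv_into U \<phi> x))"
  shows "f \<in> smooth_functions A"
proof -
  have "isCont f p" for p
  proof -
    obtain U \<phi> where U: "(U, \<phi>) \<in> A" "p \<in> U" by (rule chart_at)
    have "continuous_on U (\<lambda>q. f (inv_into U \<phi> (\<phi> q)))"
      by (rule continuous_on_compose2[OF smooth_on_imp_continuous[OF assms[OF U(1)]]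
            homeomorphism_cont1[OF chart_homeomorphism[OF U(1)]]]) simp
    then have "continuous_on U f" by (rule continuous_on_eq) (simp add: U(1))
    then show ?thesis using open_chart[OF U(1)] U(2) by (simp add: continuous_on_eq_continuous_at)
  qed
  then show ?thesis
    using assms by (auto simp: smooth_functions_def smooth_map_def o_def continuous_at_imp_continuous_on)
qed

lemma smooth_functions_const: "(\<lambda>_. c) \<in> smooth_functions A"
  by (rule smooth_functionsI) (simp add: smooth_on_const open_chart_image)

lemma smooth_functions_0 [simp]: "0 \<in> smooth_functions A"
  using smooth_functions_const[of 0] by (simp add: zero_fun_def)

lemma smooth_functions_add [simp]:
  "f \<in> smooth_functions A \<Longrightarrow> g \<in> smooth_functions A \<Longrightarrow> f + g \<in> smooth_functions A"
  by (rule smooth_functionsI) (simp add: smooth_on_add open_chart_image smooth_functionsD)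

lemma smooth_functions_mult [simp]:
  "f \<in> smooth_functions A \<Longrightarrow> g \<in> smooth_functions A \<Longrightarrow> f * g \<in> smooth_functions A"
  by (rule smooth_functionsI) (simp add: smooth_on_mult open_chart_image smooth_functionsD)

lemma smooth_functions_scaleR [simp]:
  assumes "f \<in> smooth_functions A"
  shows "c *\<^sub>R f \<in> smooth_functions A"
proof -
  have "c *\<^sub>R f = (\<lambda>_. c) * f" by (simp add: fun_eq_iff scaleR_fun_def)
  then show ?thesis using assms smooth_functions_const by simp
qed

lemma smooth_functions_uminus [simp]:
  "f \<in> smooth_functions A \<Longrightarrow> - f \<in> smooth_functions A"
  using smooth_functions_scaleR[of f "-1"] by simp

lemma smooth_functions_minus [simp]:
  "f \<in> smooth_functions A \<Longrightarrow> g \<in> smooth_functions A \<Longrightarrow> f - g \<in> smooth_functions A"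
  unfolding diff_conv_add_uminus by (intro smooth_functions_add smooth_functions_uminus)

lemma smooth_functions_sum [simp]:
  "(\<And>i. i \<in> I \<Longrightarrow> f i \<in> smooth_functions A) \<Longrightarrow> sum f I \<in> smooth_functions A"
  by (induction I rule: infinite_finite_induct) simp_all

text \<open>Near each point one chart of choice suffices; every other chart is reached through a
  smooth transition map.\<close>

lemma smooth_functionsI_local:
  assumes "\<And>p. \<exists>U \<phi> N. (U, \<phi>) \<in> A \<and> open N \<and> p \<in> N \<and> N \<subseteq> U \<and>
    smooth_on (\<phi> ` N) (\<lambda>x. f (inv_into U \<phi> x))"
  shows "f \<in> smooth_functions A"
proof (rule smooth_functionsI, rule smooth_on_locally)
  fix V \<psi> y assume V: "(V, \<psi>) \<in> A" and "y \<in> \<psi> ` V"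
  then obtain p where p: "p \<in> V" "y = \<psi> p" by auto
  obtain U \<phi> N where U: "(U, \<phi>) \<in> A" and N: "open N" "p \<in> N" "N \<subseteq> U"
    and f: "smooth_on (\<phi> ` N) (\<lambda>x. f (inv_into U \<phi> x))" using assms by blast
  define T where "T = \<psi> ` (V \<inter> N)"
  have T: "open T" unfolding T_def by (rule open_chart_image_Int[OF V N(1)])
  have "U \<inter> N = N" using N(3) by auto
  then have \<phi>N: "open (\<phi> ` N)" using open_chart_image_Int[OF U N(1)] by simp
  have "smooth_on T (\<lambda>x. \<phi> (inv_into V \<psi> x))"
    using smooth_on_subset[OF smooth_transition[OF V U], of T] N(3) by (auto simp: T_def o_def)
  then have "smooth_on T (\<lambda>x. f (inv_into U \<phi> (\<phi> (inv_into V \<psi> x))))"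
    by (rule smooth_on_compose[OF T \<phi>N f]) (auto simp: T_def V)
  then have "smooth_on T (\<lambda>x. f (inv_into V \<psi> x))"
    by (rule smooth_on_cong[OF T, rotated]) (use N(3) in \<open>auto simp: T_def V U\<close>)
  then show "\<exists>T. open T \<and> y \<in> T \<and> smooth_on T (\<lambda>x. f (inv_into V \<psi> x))"
    using T p N(2) by (auto simp: T_def)
qed

text \<open>Multiplying by a bump function supported in the half-radius ball and extending by 0
  makes a function on the coordinate ball \<open>S\<close> global. \<open>\<beta>\<close> is fixed
  before \<open>h\<close>, so several functions can share one cutoff.\<close>

lemma cutoff_exists:
  assumes U: "(U, \<phi>) \<in> A" and p: "p \<in> U"
  obtains S \<beta> where "open S" "convex S" "\<phi> p \<in> S" "S \<subseteq> \<phi> ` U" "\<beta> (\<phi> p) = (1::real)"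
    "\<And>h. smooth_on S h \<Longrightarrow>
      (\<lambda>q. if q \<in> U \<and> \<phi> q \<in> S then \<beta> (\<phi> q) * h (\<phi> q) else 0) \<in> smooth_functions A"
proof -
  obtain R where R: "R > 0" "ball (\<phi> p) R \<subseteq> \<phi> ` U"
    by (rule openE[OF open_chart_image[OF U] imageI[OF p]])
  obtain \<beta> :: "'e \<Rightarrow> real" where \<beta>: "smooth_on UNIV \<beta>" "\<beta> (\<phi> p) = 1" "\<forall>x. x \<notin> ball (\<phi> p) (R/2) \<longrightarrow> \<beta> x = 0"
    by (rule bump_function_exists[OF half_gt_zero[OF R(1)], of "\<phi> p"])
  define S where "S = ball (\<phi> p) R"
  define K where "K = inv_into U \<phi> ` cball (\<phi> p) (R/2)"
  have cball_S: "cball (\<phi> p) (R/2) \<subseteq> S" using R(1) by (auto simp: S_def)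
  have SU: "S \<subseteq> \<phi> ` U" using R(2) by (simp add: S_def)
  have "compact K" unfolding K_def
  proof (rule compact_continuous_image)
    show "continuous_on (cball (\<phi> p) (R/2)) (inv_into U \<phi>)"
      using chart_homeomorphism[OF U] cball_S SU
      by (auto simp: homeomorphism_def intro: continuous_on_subset)
  qed simp
  \<comment> \<open>Here the Hausdorff property is used: the compact set \<open>K\<close> is closed,
    so off \<open>K\<close> the extended function vanishes on an open set.\<close>
  then have K: "open (- K)" by (simp add: compact_imp_closed open_Compl)
  have K_N: "q \<in> U \<and> \<phi> q \<in> S" if q: "q \<in> K" for q
  proof -
    obtain x where x: "x \<in> cball (\<phi> p) (R/2)" "q = inv_into U \<phi> x" using q unfolding K_def by auto
    then have "x \<in> S" "x \<in> \<phi> ` U" using cball_S SU by auto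
    then show ?thesis using x(2) by (simp add: f_inv_into_f inv_into_into)
  qed
  show ?thesis
  proof
    show "open S" "convex S" "\<phi> p \<in> S" "S \<subseteq> \<phi> ` U" "\<beta> (\<phi> p) = 1"
      using R \<beta>(2) by (auto simp: S_def)
    fix h :: "'e \<Rightarrow> real" assume h: "smooth_on S h"
    define f where "f = (\<lambda>q. if q \<in> U \<and> \<phi> q \<in> S then \<beta> (\<phi> q) * h (\<phi> q) else 0)"
    show "f \<in> smooth_functions A"
    proof (rule smooth_functionsI_local)
      fix q
      show "\<exists>U \<phi> N. (U, \<phi>) \<in> A \<and> open N \<and> q \<in> N \<and> N \<subseteq> U \<and> smooth_on (\<phi> ` N) (\<lambda>x. f (inv_into U \<phi> x))"
      proof (cases "q \<in> K")
        case True
        define N where "N = U \<inter> \<phi> -` S"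
        have "open N" unfolding N_def
          using chart_homeomorphism[OF U] open_chart[OF U]
          by (intro continuous_open_preimage) (auto simp: homeomorphism_def S_def)
        moreover have "\<phi> ` N = S" using SU by (auto simp: N_def)
        moreover have "smooth_on S (\<lambda>x. f (inv_into U \<phi> x))"
        proof (rule smooth_on_cong)
          show "smooth_on S (\<lambda>x. \<beta> x * h x)"
            using \<beta>(1) h by (intro smooth_on_mult) (auto simp: S_def intro: smooth_on_subset)
          show "\<beta> x * h x = f (inv_into U \<phi> x)" if "x \<in> S" for x
            using that SU U by (auto simp: f_def)
        qed (simp add: S_def)
        ultimately show ?thesis using U K_N[OF True]
          by (intro exI[of _ U] exI[of _ \<phi>] exI[of _ N]) (auto simp: N_def)
      next
        case False
        obtain V \<psi> where V: "(V, \<psi>) \<in> A" "q \<in> V" by (rule chart_at)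
        have f0: "f q' = 0" if "q' \<notin> K" for q'
        proof -
          have "\<beta> (\<phi> q') = 0" if "q' \<in> U"
          proof (rule \<beta>(3)[rule_format], rule notI)
            assume "\<phi> q' \<in> ball (\<phi> p) (R/2)"
            then have "inv_into U \<phi> (\<phi> q') \<in> K" unfolding K_def by (intro imageI) auto
            then show False using \<open>q' \<notin> K\<close> that U by simp
          qed
          then show ?thesis by (simp add: f_def)
        qed
        have op: "open (\<psi> ` (V \<inter> - K))" by (rule open_chart_image_Int[OF V(1) K])
        have "smooth_on (\<psi> ` (V \<inter> - K)) (\<lambda>x. f (inv_into V \<psi> x))"
          by (rule smooth_on_cong[OF op _ smooth_on_const[OF op, where c = 0]]) (auto simp: V f0)
        then show ?thesis using V False K open_chart[OF V(1)]
          by (intro exI[of _ V] exI[of _ \<psi>] exI[of _ "V \<inter> - K"]) auto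
      qed
    qed
  qed
qed

section \<open>Tangent vectors as derivations\<close>

lemma
  assumes "u \<in> tangent_space A p"
  shows tangent_add: "f \<in> smooth_functions A \<Longrightarrow> g \<in> smooth_functions A \<Longrightarrow> u (f + g) = u f + u g"
    and tangent_mult: "f \<in> smooth_functions A \<Longrightarrow> g \<in> smooth_functions A \<Longrightarrow> u (f * g) = u f * g p + f p * u g"
    and tangent_scaleR: "f \<in> smooth_functions A \<Longrightarrow> u (c *\<^sub>R f) = c * u f"
    and tangent_nonsmooth: "f \<notin> smooth_functions A \<Longrightarrow> u f = 0"
  using assms by (auto simp: tangent_space_def)

lemma tangent_0: "u \<in> tangent_space A p \<Longrightarrow> u 0 = 0"
  using tangent_scaleR[of u p 0 0] by simp

lemma tangent_const:
  assumes "u \<in> tangent_space A p"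
  shows "u (\<lambda>_. c) = 0"
proof -
  have "u (1 * 1) = u 1 + u 1"
    using tangent_mult[OF assms, of 1 1] smooth_functions_const[of 1] by (simp add: one_fun_def)
  then have "u 1 = 0" by simp
  then show ?thesis
    using tangent_scaleR[OF assms, of 1 c] smooth_functions_const[of 1]
    by (simp add: one_fun_def scaleR_fun_def)
qed

lemma tangent_diff:
  assumes "u \<in> tangent_space A p" "f \<in> smooth_functions A" "g \<in> smooth_functions A"
  shows "u (f - g) = u f - u g"
  using tangent_add[OF assms(1,2), of "(-1) *\<^sub>R g"] tangent_scaleR[OF assms(1,3), of "-1"] assms by simp

lemma tangent_sum:
  assumes "u \<in> tangent_space A p" "\<And>i. i \<in> I \<Longrightarrow> f i \<in> smooth_functions A"
  shows "u (sum f I) = (\<Sum>i\<in>I. u (f i))"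
  using assms(2)
  by (induction I rule: infinite_finite_induct)
    (simp_all add: tangent_0[OF assms(1)] tangent_add[OF assms(1)])

lemma subspace_tangent_space: "subspace (tangent_space A p)"
  by (rule subspaceI) (auto simp: tangent_space_def scaleR_fun_def algebra_simps)

text \<open>Hadamard's lemma exhibits \<open>f - f p\<close> near \<open>p\<close> as a sum of
  products of coordinate functions \<open>l b\<close> with functions \<open>g b\<close>, and Leibniz
  at \<open>p\<close> leaves the coefficient \<open>u (E (l b))\<close>. It is essential that
  \<open>c\<close> precedes \<open>f\<close>: later \<open>f\<close> is translated while
  \<open>c\<close> stays fixed.\<close>

lemma tangent_expansion:
  assumes U: "(U, \<phi>) \<in> A" and p: "p \<in> U" and u: "u \<in> tangent_space A p"
  obtains c where "\<And>f. f \<in> smooth_functions A \<Longrightarrow>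
    u f = (\<Sum>b\<in>Basis. c b * frechet_derivative (\<lambda>x. f (inv_into U \<phi> x)) (at (\<phi> p)) b)"
proof -
  obtain S \<beta> where S: "open S" "convex S" "\<phi> p \<in> S" "S \<subseteq> \<phi> ` U" "\<beta> (\<phi> p) = (1::real)"
    and ext: "\<And>h. smooth_on S h \<Longrightarrow>
      (\<lambda>q. if q \<in> U \<and> \<phi> q \<in> S then \<beta> (\<phi> q) * h (\<phi> q) else 0) \<in> smooth_functions A"
    using cutoff_exists[OF U p] by blast
  define E where "E = (\<lambda>h q. if q \<in> U \<and> \<phi> q \<in> S then \<beta> (\<phi> q) * h (\<phi> q) else 0)"
  have E: "E h \<in> smooth_functions A" if "smooth_on S h" for h
    unfolding E_def by (rule ext[OF that])
  define l where "l = (\<lambda>b x. (x - \<phi> p) \<bullet> b)"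
  have l: "smooth_on S (l b)" for b
  proof -
    have "smooth_on S (\<lambda>x. x \<bullet> b + - (\<phi> p \<bullet> b))"
      by (intro smooth_on_add smooth_on_const smooth_on_bounded_linear bounded_linear_inner_left S(1))
    then show ?thesis by (simp add: l_def inner_diff_left)
  qed
  show ?thesis
  proof
    fix f assume f: "f \<in> smooth_functions A"
    have "smooth_on S (\<lambda>x. f (inv_into U \<phi> x))"
      by (rule smooth_on_subset[OF smooth_functionsD[OF f U] S(4)])
    then obtain g where g: "\<And>b. smooth_on S (g b)"
      "\<And>b. g b (\<phi> p) = frechet_derivative (\<lambda>x. f (inv_into U \<phi> x)) (at (\<phi> p)) b"
      and exp: "\<And>x. x \<in> S \<Longrightarrow> f (inv_into U \<phi> x) = f (inv_into U \<phi> (\<phi> p)) + (\<Sum>b\<in>Basis. l b x * g b x)"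
      unfolding l_def by (rule hadamard[OF S(1-3)]) blast
    define \<eta> where "\<eta> = E (\<lambda>_. 1)"
    have \<eta>: "\<eta> \<in> smooth_functions A" unfolding \<eta>_def by (intro E smooth_on_const S(1))
    have \<eta>p: "\<eta> p = 1" using p S(3,5) by (simp add: \<eta>_def E_def)
    define f0 where "f0 = f - (\<lambda>_. f p)"
    have f0: "f0 \<in> smooth_functions A" unfolding f0_def by (intro smooth_functions_minus f smooth_functions_const)
    have u_f0: "u f0 = u f"
      unfolding f0_def tangent_diff[OF u f smooth_functions_const] by (simp add: tangent_const[OF u])
    have one: "1 \<in> smooth_functions A" using smooth_functions_const[of 1] by (simp add: one_fun_def)
    have "f0 = \<eta> * \<eta> * f0 + (1 - \<eta> * \<eta>) * f0" by (simp add: algebra_simps)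
    then have "u f0 = u (\<eta> * \<eta> * f0) + u ((1 - \<eta> * \<eta>) * f0)"
      using tangent_add[OF u, of "\<eta> * \<eta> * f0" "(1 - \<eta> * \<eta>) * f0"] f0 \<eta> one by simp
    \<comment> \<open>Both factors vanish at \<open>p\<close>, so Leibniz gives 0; this is how a
      derivation on global functions becomes local.\<close>
    also have "u ((1 - \<eta> * \<eta>) * f0) = 0"
      using tangent_mult[OF u, of "1 - \<eta> * \<eta>" f0] f0 \<eta> one \<eta>p by (simp add: f0_def)
    \<comment> \<open>\<open>E (l b)\<close> and \<open>E (g b)\<close> each carry one cutoff, hence
      the square of \<open>\<eta>\<close>.\<close>
    also have "\<eta> * \<eta> * f0 = (\<Sum>b\<in>Basis. E (l b) * E (g b))"
    proof
      fix q
      show "(\<eta> * \<eta> * f0) q = (\<Sum>b\<in>Basis. E (l b) * E (g b)) q"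
      proof (cases "q \<in> U \<and> \<phi> q \<in> S")
        case True
        then show ?thesis
          using exp[of "\<phi> q"] p U
          by (simp add: sum_fun_apply \<eta>_def E_def f0_def sum_distrib_left algebra_simps)
      next
        case False
        then have "E h q = 0" for h by (auto simp: E_def)
        then show ?thesis by (simp add: sum_fun_apply \<eta>_def)
      qed
    qed
    also have "u (\<Sum>b\<in>Basis. E (l b) * E (g b)) = (\<Sum>b\<in>Basis. u (E (l b) * E (g b)))"
      by (rule tangent_sum[OF u]) (simp add: E l g)
    also have "\<dots> = (\<Sum>b\<in>Basis. u (E (l b)) * g b (\<phi> p))"
      using tangent_mult[OF u E[OF l] E[OF g(1)]] p S(3,5) by (simp add: E_def l_def)
    finally show "u f = (\<Sum>b\<in>Basis. u (E (l b)) *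
        frechet_derivative (\<lambda>x. f (inv_into U \<phi> x)) (at (\<phi> p)) b)"
      by (simp add: u_f0 g(2))
  qed
qed

text \<open>Only a finite spanning set is claimed, so the \<open>d b\<close> need not be shown to be
  tangent vectors themselves. They are 0 off the smooth functions to match the normalisation of
  tangent vectors.\<close>

lemma tangent_space_finite_span:
  obtains T where "finite T" "tangent_space A p \<subseteq> span T"
proof -
  obtain U \<phi> where U: "(U, \<phi>) \<in> A" "p \<in> U" by (rule chart_at)
  define d where "d = (\<lambda>b f. if f \<in> smooth_functions A then
    frechet_derivative (\<lambda>x. f (inv_into U \<phi> x)) (at (\<phi> p)) b else 0)"
  show ?thesis
  proof
    show "finite (d ` Basis)" by simp
    show "tangent_space A p \<subseteq> span (d ` Basis)"
    proof
      fix u assume u: "u \<in> tangent_space A p"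
      obtain c where c: "\<And>f. f \<in> smooth_functions A \<Longrightarrow>
        u f = (\<Sum>b\<in>Basis. c b * frechet_derivative (\<lambda>x. f (inv_into U \<phi> x)) (at (\<phi> p)) b)"
        using tangent_expansion[OF U u] by blast
      have "u = (\<Sum>b\<in>Basis. c b *\<^sub>R d b)"
      proof
        fix f
        show "u f = (\<Sum>b\<in>Basis. c b *\<^sub>R d b) f"
          using c tangent_nonsmooth[OF u]
          by (cases "f \<in> smooth_functions A") (simp_all add: sum_fun_apply scaleR_fun_def d_def)
      qed
      also have "\<dots> \<in> span (d ` Basis)"
        by (intro span_sum span_scale span_base imageI)
      finally show "u \<in> span (d ` Basis)" .
    qed
  qed
qed

end

section \<open>Left-invariant vector fields\<close>

locale lie_grp =
  fixes A :: "('g::{t2_space,second_countable_topology}, 'e::euclidean_space) atlas"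
    and mul :: "'g \<Rightarrow> 'g \<Rightarrow> 'g" and e :: 'g and iv :: "'g \<Rightarrow> 'g"
  assumes lie_group: "lie_group A mul e iv"
begin

sublocale smooth_manifold A
  using lie_group by unfold_locales (simp add: lie_group_def)

sublocale group mul e iv
  using lie_group by (simp add: lie_group_def)

section \<open>Left translations and left-invariant fields\<close>

lemma mul_iv_cancel [simp]: "mul g (mul (iv g) p) = p" "mul (iv g) (mul g p) = p"
  by (simp_all add: assoc[symmetric])

lemma comp_mul: "f \<circ> mul g \<circ> mul h = f \<circ> mul (mul g h)"
  by (simp add: fun_eq_iff assoc)

lemma comp_mul_iv [simp]: "f \<circ> mul g \<circ> mul (iv g) = f" "f \<circ> mul (iv g) \<circ> mul g = f"
  by (simp_all add: fun_eq_iff)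

text \<open>Joint smoothness in both factors is recorded in coordinates, so that a partial
  derivative in the second variable will be smooth in the first. The chart around the product
  varies, hence the local argument.\<close>

lemma smooth_on_mul:
  assumes f: "f \<in> smooth_functions A" and U: "(U, \<phi>) \<in> A" and V: "(V, \<psi>) \<in> A"
  shows "smooth_on (\<phi> ` U \<times> \<psi> ` V) (\<lambda>z. f (mul (inv_into U \<phi> (fst z)) (inv_into V \<psi> (snd z))))"
proof (rule smooth_on_locally)
  let ?m = "\<lambda>(x, y). mul x y" and ?I = "\<lambda>z. (inv_into U \<phi> (fst z), inv_into V \<psi> (snd z))"
  have mul: "smooth_map (prod_atlas A A) A ?m" using lie_group by (simp add: lie_group_def)
  fix z assume z: "z \<in> \<phi> ` U \<times> \<psi> ` V"
  obtain W \<kappa> where W: "(W, \<kappa>) \<in> A" "?m (?I z) \<in> W" by (rule chart_at)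
  define T where "T = (\<phi> ` U \<times> \<psi> ` V) \<inter> (\<lambda>z. ?m (?I z)) -` W"
  have "continuous_on (\<phi> ` U \<times> \<psi> ` V) ?I"
    using homeomorphism_cont2[OF chart_homeomorphism[OF U]] homeomorphism_cont2[OF chart_homeomorphism[OF V]]
    by (intro continuous_on_Pair continuous_on_compose2[OF _ continuous_on_fst[OF continuous_on_id]]
        continuous_on_compose2[OF _ continuous_on_snd[OF continuous_on_id]]) auto
  then have "continuous_on (\<phi> ` U \<times> \<psi> ` V) (\<lambda>z. ?m (?I z))"
    using mul by (intro continuous_on_compose2[of UNIV ?m _ ?I]) (auto simp: smooth_map_def)
  then have T: "open T" unfolding T_def
    by (intro continuous_open_preimage open_Times open_chart_image[OF U] open_chart_image[OF V] open_chart[OF W(1)])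
  have inv: "inv_into (U \<times> V) (map_prod \<phi> \<psi>) z' = ?I z'" if "z' \<in> \<phi> ` U \<times> \<psi> ` V" for z'
  proof -
    have "inj_on \<phi> U" "inj_on \<psi> V"
      using U V by (metis chart_inv inj_onI)+
    then have "inj_on (map_prod \<phi> \<psi>) (U \<times> V)" by (rule map_prod_inj_on)
    moreover have "z' = map_prod \<phi> \<psi> (?I z')" "?I z' \<in> U \<times> V"
      using that by (auto simp: f_inv_into_f inv_into_into)
    ultimately show ?thesis by (metis inv_into_f_f)
  qed
  have "(U \<times> V, map_prod \<phi> \<psi>) \<in> prod_atlas A A"
    using U V by (force simp: prod_atlas_def)
  then have "smooth_on (map_prod \<phi> \<psi> ` (U \<times> V \<inter> ?m -` W)) (\<kappa> \<circ> ?m \<circ> inv_into (U \<times> V) (map_prod \<phi> \<psi>))"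
    using mul W(1) by (auto simp: smooth_map_def)
  moreover have "T \<subseteq> map_prod \<phi> \<psi> ` (U \<times> V \<inter> ?m -` W)"
  proof
    fix z' assume "z' \<in> T"
    then have "z' = map_prod \<phi> \<psi> (?I z')" "?I z' \<in> U \<times> V \<inter> ?m -` W"
      by (auto simp: T_def f_inv_into_f inv_into_into)
    then show "z' \<in> map_prod \<phi> \<psi> ` (U \<times> V \<inter> ?m -` W)" by (rule image_eqI)
  qed
  ultimately have "smooth_on T (\<kappa> \<circ> ?m \<circ> inv_into (U \<times> V) (map_prod \<phi> \<psi>))" by (rule smooth_on_subset)
  then have "smooth_on T (\<lambda>z. \<kappa> (?m (?I z)))"
    by (rule smooth_on_cong[OF T, rotated]) (auto simp: T_def inv)
  then have "smooth_on T (\<lambda>z. f (inv_into W \<kappa> (\<kappa> (?m (?I z)))))"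
    by (rule smooth_on_compose[OF T open_chart_image[OF W(1)] smooth_functionsD[OF f W(1)]]) (auto simp: T_def)
  then have "smooth_on T (\<lambda>z. f (mul (inv_into U \<phi> (fst z)) (inv_into V \<psi> (snd z))))"
    by (rule smooth_on_cong[OF T, rotated]) (auto simp: T_def W)
  then show "\<exists>T. open T \<and> z \<in> T \<and> smooth_on T (\<lambda>z. f (mul (inv_into U \<phi> (fst z)) (inv_into V \<psi> (snd z))))"
    using T z W(2) by (auto simp: T_def)
qed

lemma smooth_left_translate [simp]:
  assumes f: "f \<in> smooth_functions A"
  shows "f \<circ> mul g \<in> smooth_functions A"
proof (rule smooth_functionsI)
  fix V \<psi> assume V: "(V, \<psi>) \<in> A"
  obtain U \<phi> where U: "(U, \<phi>) \<in> A" "g \<in> U" by (rule chart_at)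
  have "smooth_on (\<psi> ` V) (\<lambda>y. (\<phi> g, y))"
    by (intro smooth_on_Pair smooth_on_const smooth_on_bounded_linear bounded_linear_ident open_chart_image[OF V])
  from smooth_on_compose[OF open_chart_image[OF V] _ smooth_on_mul[OF f U(1) V] this]
  show "smooth_on (\<psi> ` V) (\<lambda>x. (f \<circ> mul g) (inv_into V \<psi> x))"
    using U by (simp add: open_Times open_chart_image[OF U(1)] open_chart_image[OF V] image_subset_iff)
qed

text \<open>The converse direction is what lets a pushed-forward tangent vector keep the value 0 on
  nonsmooth functions.\<close>

lemma smooth_left_translate_iff: "f \<circ> mul g \<in> smooth_functions A \<longleftrightarrow> f \<in> smooth_functions A"
  using smooth_left_translate[of "f \<circ> mul g" "iv g"] by auto

lemma comp_distrib:
  "(f + h) \<circ> k = (f \<circ> k) + (h \<circ> k)" "(f * h) \<circ> k = (f \<circ> k) * (h \<circ> k)" "(c *\<^sub>R f) \<circ> k = c *\<^sub>R (f \<circ> k)"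
  for f h :: "'b \<Rightarrow> real" and k :: "'c \<Rightarrow> 'b"
  by (simp_all add: fun_eq_iff scaleR_fun_def)

lemma push_tangent_in:
  assumes u: "u \<in> tangent_space A p"
  shows "push_tangent mul g u \<in> tangent_space A (mul g p)"
  using tangent_add[OF u] tangent_mult[OF u] tangent_scaleR[OF u] tangent_nonsmooth[OF u]
  unfolding tangent_space_def push_tangent_def
  by (simp add: comp_distrib smooth_left_translate_iff)

lemma push_tangent_cancel [simp]:
  "push_tangent mul g (push_tangent mul (iv g) u) = u"
  "push_tangent mul (iv g) (push_tangent mul g u) = u"
  by (simp_all add: push_tangent_def)

definition left_field :: "'g tangent \<Rightarrow> 'g vfield" where
  "left_field u = (\<lambda>f g. u (f \<circ> mul g))"

lemma value_left_field: "value_at (left_field u) g = push_tangent mul g u"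
  by (simp add: left_field_def value_at_def push_tangent_def)

text \<open>The coefficients of \<open>u\<close> in a chart at \<open>e\<close> do not depend on the
  group element. So in coordinates the function is a fixed combination of partial derivatives of
  multiplication followed by \<open>f\<close>, taken in the second variable at
  \<open>e\<close>.\<close>

lemma left_field_smooth:
  assumes u: "u \<in> tangent_space A e" and f: "f \<in> smooth_functions A"
  shows "left_field u f \<in> smooth_functions A"
proof (rule smooth_functionsI)
  fix U \<phi> assume U: "(U, \<phi>) \<in> A"
  obtain V \<psi> where V: "(V, \<psi>) \<in> A" "e \<in> V" by (rule chart_at)
  obtain c where c: "\<And>f. f \<in> smooth_functions A \<Longrightarrow>
    u f = (\<Sum>b\<in>Basis. c b * frechet_derivative (\<lambda>x. f (inv_into V \<psi> x)) (at (\<psi> e)) b)"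
    using tangent_expansion[OF V u] by blast
  define G where "G = (\<lambda>z. f (mul (inv_into U \<phi> (fst z)) (inv_into V \<psi> (snd z))))"
  have G: "smooth_on (\<phi> ` U \<times> \<psi> ` V) G" unfolding G_def by (rule smooth_on_mul[OF f U V(1)])
  have op: "open (\<phi> ` U \<times> \<psi> ` V)" by (simp add: open_Times open_chart_image[OF U] open_chart_image[OF V(1)])
  have "smooth_on (\<phi> ` U) (\<lambda>x. frechet_derivative G (at (x, \<psi> e)) (0, b))" for b
  proof (rule smooth_on_compose[OF open_chart_image[OF U] op smooth_on_derivative[OF G]])
    show "smooth_on (\<phi> ` U) (\<lambda>x. (x, \<psi> e))"
      by (intro smooth_on_Pair smooth_on_const smooth_on_bounded_linear bounded_linear_ident open_chart_image[OF U])
  qed (use V in auto)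
  then have "smooth_on (\<phi> ` U) (\<lambda>x. \<Sum>b\<in>Basis. c b * frechet_derivative G (at (x, \<psi> e)) (0, b))"
    by (intro smooth_on_sum smooth_on_mult smooth_on_const open_chart_image[OF U])
  then show "smooth_on (\<phi> ` U) (\<lambda>x. left_field u f (inv_into U \<phi> x))"
  proof (rule smooth_on_cong[OF open_chart_image[OF U], rotated])
    fix x assume x: "x \<in> \<phi> ` U"
    let ?g = "inv_into U \<phi> x"
    have "((\<lambda>y. G (x, y)) has_derivative (\<lambda>v. frechet_derivative G (at (x, \<psi> e)) (0, v))) (at (\<psi> e))"
      by (rule has_derivative_compose[OF _ smooth_on_has_derivative[OF G]])
        (use x V in \<open>auto intro!: derivative_eq_intros\<close>)
    then have "frechet_derivative (\<lambda>y. G (x, y)) (at (\<psi> e)) = (\<lambda>v. frechet_derivative G (at (x, \<psi> e)) (0, v))"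
      by (rule frechet_derivative_at[symmetric])
    then show "(\<Sum>b\<in>Basis. c b * frechet_derivative G (at (x, \<psi> e)) (0, b)) = left_field u f ?g"
      using c[of "f \<circ> mul ?g"] f by (simp add: left_field_def G_def)
  qed
qed

lemma left_field_in:
  assumes u: "u \<in> tangent_space A e"
  shows "left_field u \<in> lie_algebra A mul iv"
proof -
  have "value_at (left_field u) p \<in> tangent_space A p" for p
    using push_tangent_in[OF u, of p] by (simp add: value_left_field)
  moreover have "push_field mul iv g (left_field u) = left_field u" for g
    by (simp add: push_field_def left_field_def fun_eq_iff comp_mul)
  ultimately show ?thesis
    using left_field_smooth[OF u] by (simp add: lie_algebra_def vector_fields_def)
qed

lemma lie_algebra_vector_field: "X \<in> lie_algebra A mul iv \<Longrightarrow> X \<in> vector_fields A"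
  by (simp add: lie_algebra_def)

lemma value_push_field: "value_at (push_field mul iv g X) p = push_tangent mul g (value_at X (mul (iv g) p))"
  by (simp add: value_at_def push_field_def push_tangent_def)

lemma value_lie_algebra:
  assumes "X \<in> lie_algebra A mul iv"
  shows "value_at X p = push_tangent mul p (value_at X e)"
proof -
  have "push_field mul iv p X = X" using assms by (simp add: lie_algebra_def)
  then show ?thesis using value_push_field[of p X p] by simp
qed

lemma left_field_value:
  assumes "X \<in> lie_algebra A mul iv"
  shows "left_field (value_at X e) = X"
  using value_lie_algebra[OF assms] by (simp add: fun_eq_iff value_at_def left_field_def push_tangent_def)

text \<open>These extensions carry nondegeneracy over to the Lie algebra, give the frame at every
  point, and witness the choice in \<open>extend_field\<close>.\<close>

lemma left_field_exists:
  assumes "v \<in> tangent_space A p"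
  obtains X where "X \<in> lie_algebra A mul iv" "value_at X p = v"
proof
  have u: "push_tangent mul (iv p) v \<in> tangent_space A e"
    using push_tangent_in[OF assms, of "iv p"] by simp
  show "left_field (push_tangent mul (iv p) v) \<in> lie_algebra A mul iv" by (rule left_field_in[OF u])
  show "value_at (left_field (push_tangent mul (iv p) v)) p = v" by (simp add: value_left_field)
qed

end

section \<open>Vector fields and forms\<close>

context smooth_manifold
begin

section \<open>Vector fields as derivations of the smooth functions\<close>

lemma value_in_tangent: "X \<in> vector_fields A \<Longrightarrow> value_at X p \<in> tangent_space A p"
  by (simp add: vector_fields_def)

lemma
  assumes X: "X \<in> vector_fields A"
  shows vf_smooth: "f \<in> smooth_functions A \<Longrightarrow> X f \<in> smooth_functions A"
    and vf_add: "f \<in> smooth_functions A \<Longrightarrow> g \<in> smooth_functions A \<Longrightarrow> X (f + g) = X f + X g"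
    and vf_mult: "f \<in> smooth_functions A \<Longrightarrow> g \<in> smooth_functions A \<Longrightarrow> X (f * g) = X f * g + f * X g"
    and vf_scaleR: "f \<in> smooth_functions A \<Longrightarrow> X (c *\<^sub>R f) = c *\<^sub>R X f"
    and vf_nonsmooth: "f \<notin> smooth_functions A \<Longrightarrow> X f = 0"
    and vf_const: "X (\<lambda>_. c) = 0"
    and vf_diff: "f \<in> smooth_functions A \<Longrightarrow> g \<in> smooth_functions A \<Longrightarrow> X (f - g) = X f - X g"
proof -
  note v = value_in_tangent[OF X, unfolded value_at_def]
  show "f \<in> smooth_functions A \<Longrightarrow> X f \<in> smooth_functions A"
    using X by (simp add: vector_fields_def)
  show "f \<in> smooth_functions A \<Longrightarrow> g \<in> smooth_functions A \<Longrightarrow> X (f + g) = X f + X g"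
    by (rule ext) (simp only: tangent_add[OF v] plus_fun_apply)
  show "f \<in> smooth_functions A \<Longrightarrow> g \<in> smooth_functions A \<Longrightarrow> X (f * g) = X f * g + f * X g"
    by (rule ext) (simp only: tangent_mult[OF v] plus_fun_apply times_fun_apply)
  show "f \<in> smooth_functions A \<Longrightarrow> X (c *\<^sub>R f) = c *\<^sub>R X f"
    by (rule ext) (simp only: tangent_scaleR[OF v] scaleR_fun_apply real_scaleR_def)
  show "f \<notin> smooth_functions A \<Longrightarrow> X f = 0"
    by (rule ext) (simp add: tangent_nonsmooth[OF v])
  show "X (\<lambda>_. c) = 0"
    by (rule ext) (simp only: tangent_const[OF v] zero_fun_apply)
  show "f \<in> smooth_functions A \<Longrightarrow> g \<in> smooth_functions A \<Longrightarrow> X (f - g) = X f - X g"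
    by (rule ext) (simp only: tangent_diff[OF v] minus_apply)
qed

lemma vf_zero: "X \<in> vector_fields A \<Longrightarrow> X 0 = 0"
  using vf_const[of X 0] by (simp add: zero_fun_def)

lemmas vf_simps = vf_smooth vf_add vf_mult vf_scaleR vf_nonsmooth vf_diff vf_zero vf_const

lemma vector_fieldsI:
  assumes "\<And>f. f \<in> smooth_functions A \<Longrightarrow> X f \<in> smooth_functions A"
    and "\<And>f g. f \<in> smooth_functions A \<Longrightarrow> g \<in> smooth_functions A \<Longrightarrow> X (f + g) = X f + X g"
    and "\<And>f g. f \<in> smooth_functions A \<Longrightarrow> g \<in> smooth_functions A \<Longrightarrow> X (f * g) = X f * g + f * X g"
    and "\<And>c f. f \<in> smooth_functions A \<Longrightarrow> X (c *\<^sub>R f) = c *\<^sub>R X f"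
    and "\<And>f. f \<notin> smooth_functions A \<Longrightarrow> X f = 0"
  shows "X \<in> vector_fields A"
  using assms by (simp add: vector_fields_def tangent_space_def value_at_def scaleR_fun_apply)

lemma vector_fields_add [simp]:
  assumes X: "X \<in> vector_fields A" and Y: "Y \<in> vector_fields A"
  shows "X + Y \<in> vector_fields A"
  by (rule vector_fieldsI)
    (simp_all add: vf_simps[OF X] vf_simps[OF Y] scaleR_add_right algebra_simps)

lemma mult_scaleR_fun: "f * (c *\<^sub>R g) = c *\<^sub>R (f * g)" for f g :: "'b \<Rightarrow> real"
  by (simp add: fun_eq_iff scaleR_fun_apply)

lemma vector_fields_fun_scale [simp]:
  assumes X: "X \<in> vector_fields A" and f: "f \<in> smooth_functions A"
  shows "fun_scale f X \<in> vector_fields A"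
  by (rule vector_fieldsI)
    (simp_all add: f fun_scale_def vf_simps[OF X] mult_scaleR_fun algebra_simps)

lemma vector_fields_0 [simp]: "0 \<in> vector_fields A"
  by (rule vector_fieldsI) simp_all

lemma vector_fields_sum [simp]:
  "(\<And>i. i \<in> I \<Longrightarrow> X i \<in> vector_fields A) \<Longrightarrow> sum X I \<in> vector_fields A"
  by (induction I rule: infinite_finite_induct) simp_all

lemma scaleR_eq_fun_scale: "c *\<^sub>R X = fun_scale (\<lambda>_. c) X" for X :: "'b vfield"
  by (simp add: fun_eq_iff fun_scale_def scaleR_fun_apply)

lemma vector_fields_scaleR [simp]: "X \<in> vector_fields A \<Longrightarrow> c *\<^sub>R X \<in> vector_fields A"
  by (simp add: scaleR_eq_fun_scale smooth_functions_const)

lemma vector_fields_uminus [simp]: "X \<in> vector_fields A \<Longrightarrow> - X \<in> vector_fields A"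
  using vector_fields_scaleR[of X "-1"] by simp

lemma vector_fields_minus [simp]: "X \<in> vector_fields A \<Longrightarrow> Y \<in> vector_fields A \<Longrightarrow> X - Y \<in> vector_fields A"
  unfolding diff_conv_add_uminus by (intro vector_fields_add vector_fields_uminus)

lemma lie_bracket_in [simp]:
  assumes X: "X \<in> vector_fields A" and Y: "Y \<in> vector_fields A"
  shows "lie_bracket X Y \<in> vector_fields A"
  by (rule vector_fieldsI)
    (simp_all add: lie_bracket_def vf_simps[OF X] vf_simps[OF Y] scaleR_diff_right algebra_simps)

lemma lie_bracket_skew: "lie_bracket X Y = - lie_bracket Y X"
  by (simp add: lie_bracket_def fun_eq_iff)

lemma vector_fields_eqI:
  assumes "X \<in> vector_fields A" "Y \<in> vector_fields A"
    "\<And>f. f \<in> smooth_functions A \<Longrightarrow> X f = Y f"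
  shows "X = Y"
proof
  fix f
  show "X f = Y f"
    by (cases "f \<in> smooth_functions A") (simp_all add: assms(3) vf_nonsmooth[OF assms(1)] vf_nonsmooth[OF assms(2)])
qed

lemma lie_bracket_add:
  assumes "X \<in> vector_fields A" "Y \<in> vector_fields A" "Z \<in> vector_fields A"
  shows "lie_bracket X (Y + Z) = lie_bracket X Y + lie_bracket X Z"
proof (rule vector_fields_eqI)
  fix h assume "h \<in> smooth_functions A"
  then show "lie_bracket X (Y + Z) h = (lie_bracket X Y + lie_bracket X Z) h"
    by (simp add: lie_bracket_def vf_simps[OF assms(1)] vf_simps[OF assms(2)] vf_simps[OF assms(3)])
qed (simp_all add: assms)

lemma lie_bracket_fun_scale:
  assumes "X \<in> vector_fields A" "Y \<in> vector_fields A" "f \<in> smooth_functions A"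
  shows "lie_bracket X (fun_scale f Y) = fun_scale (X f) Y + fun_scale f (lie_bracket X Y)"
proof (rule vector_fields_eqI)
  fix h assume h: "h \<in> smooth_functions A"
  show "lie_bracket X (fun_scale f Y) h = (fun_scale (X f) Y + fun_scale f (lie_bracket X Y)) h"
    using assms(3) h
    by (simp add: lie_bracket_def fun_scale_def vf_simps[OF assms(1)] vf_simps[OF assms(2)] algebra_simps)
qed (simp_all add: assms vf_smooth[OF assms(1)])

lemma lie_bracket_scaleR:
  assumes "X \<in> vector_fields A" "Y \<in> vector_fields A"
  shows "lie_bracket X (c *\<^sub>R Y) = c *\<^sub>R lie_bracket X Y"
proof -
  have "fun_scale (0 :: 'a \<Rightarrow> real) Y = 0" "fun_scale (\<lambda>_. 0) Y = 0"
    by (simp_all add: fun_scale_def fun_eq_iff)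
  then show ?thesis
    using assms by (simp add: scaleR_eq_fun_scale lie_bracket_fun_scale smooth_functions_const vf_const)
qed

lemma lie_bracket_jacobi:
  assumes "X \<in> vector_fields A" "Y \<in> vector_fields A" "Z \<in> vector_fields A"
  shows "lie_bracket (lie_bracket X Y) Z = lie_bracket X (lie_bracket Y Z) - lie_bracket Y (lie_bracket X Z)"
proof (rule vector_fields_eqI)
  fix h assume "h \<in> smooth_functions A"
  then show "lie_bracket (lie_bracket X Y) Z h = (lie_bracket X (lie_bracket Y Z) - lie_bracket Y (lie_bracket X Z)) h"
    by (simp add: lie_bracket_def vf_simps[OF assms(1)] vf_simps[OF assms(2)] vf_simps[OF assms(3)])
qed (simp_all add: assms)

lemma
  fixes X Y :: "'b vfield" and Z :: "'i \<Rightarrow> 'b vfield"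
  shows value_add: "value_at (X + Y) p = value_at X p + value_at Y p"
    and value_fun_scale: "value_at (fun_scale f X) p = f p *\<^sub>R value_at X p"
    and value_scaleR: "value_at (c *\<^sub>R X) p = c *\<^sub>R value_at X p"
    and value_sum: "value_at (sum Z I) p = (\<Sum>i\<in>I. value_at (Z i) p)"
  by (simp_all add: value_at_def fun_eq_iff fun_scale_def scaleR_fun_apply sum_fun_apply)

end

locale two_form_manifold = smooth_manifold A
  for A :: "('a::t2_space, 'e::euclidean_space) atlas" +
  fixes \<omega> :: "'a two_tensor"
  assumes two_form: "two_form A \<omega>"
begin

lemma form_add:
  "\<lbrakk>u \<in> tangent_space A p; v \<in> tangent_space A p; x \<in> tangent_space A p\<rbrakk> \<Longrightarrow> \<omega> p (u + v) x = \<omega> p u x + \<omega> p v x"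
  using two_form unfolding two_form_def by blast

lemma form_scaleR:
  "\<lbrakk>u \<in> tangent_space A p; x \<in> tangent_space A p\<rbrakk> \<Longrightarrow> \<omega> p (c *\<^sub>R u) x = c * \<omega> p u x"
  using two_form unfolding two_form_def by blast

lemma form_skew: "u \<in> tangent_space A p \<Longrightarrow> v \<in> tangent_space A p \<Longrightarrow> \<omega> p u v = - \<omega> p v u"
  using two_form unfolding two_form_def by blast

lemma tensor_app_smooth [simp]:
  "X \<in> vector_fields A \<Longrightarrow> Y \<in> vector_fields A \<Longrightarrow> tensor_app \<omega> X Y \<in> smooth_functions A"
  using two_form by (simp add: two_form_def)

lemma
  assumes "X \<in> vector_fields A" "Y \<in> vector_fields A" "Z \<in> vector_fields A"
  shows tensor_app_add: "tensor_app \<omega> (X + Y) Z = tensor_app \<omega> X Z + tensor_app \<omega> Y Z"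
    and tensor_app_fun_scale: "tensor_app \<omega> (fun_scale f X) Z = f * tensor_app \<omega> X Z"
  using value_in_tangent[OF assms(1)] value_in_tangent[OF assms(2)] value_in_tangent[OF assms(3)]
  by (simp_all add: tensor_app_def fun_eq_iff value_add value_fun_scale form_add form_scaleR)

lemma tensor_app_skew:
  assumes "X \<in> vector_fields A" "Y \<in> vector_fields A"
  shows "tensor_app \<omega> X Y = - tensor_app \<omega> Y X"
  using form_skew[OF value_in_tangent[OF assms(1)] value_in_tangent[OF assms(2)]]
  by (simp add: tensor_app_def fun_eq_iff)

lemma
  assumes "X \<in> vector_fields A" "Y \<in> vector_fields A" "Z \<in> vector_fields A" "f \<in> smooth_functions A"
  shows tensor_app_add_right: "tensor_app \<omega> Z (X + Y) = tensor_app \<omega> Z X + tensor_app \<omega> Z Y"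
    and tensor_app_fun_scale_right: "tensor_app \<omega> Z (fun_scale f X) = f * tensor_app \<omega> Z X"
  using tensor_app_skew[of Z "X + Y"] tensor_app_skew[of Z X] tensor_app_skew[of Z Y]
    tensor_app_skew[of Z "fun_scale f X"] assms
  by (simp_all add: tensor_app_add tensor_app_fun_scale[of X X Z])

end

context lie_grp
begin

section \<open>The Lie algebra and its lower central series\<close>

abbreviation lie_alg :: "'g vfield set" where
  "lie_alg \<equiv> lie_algebra A mul iv"

lemma lie_algebra_translate:
  assumes "X \<in> lie_alg"
  shows "X (f \<circ> mul g) = X f \<circ> mul g"
proof -
  have "push_field mul iv g X = X" using assms by (simp add: lie_algebra_def)
  from fun_cong[OF this, of f] have "X (f \<circ> mul g) \<circ> mul (iv g) = X f"
    by (simp add: push_field_def)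
  then have "X (f \<circ> mul g) \<circ> mul (iv g) \<circ> mul g = X f \<circ> mul g" by (simp only:)
  then show ?thesis by simp
qed

lemma lie_algebraI:
  assumes "X \<in> vector_fields A" "\<And>f g. X (f \<circ> mul g) = X f \<circ> mul g"
  shows "X \<in> lie_alg"
  using assms by (simp add: lie_algebra_def push_field_def fun_eq_iff)

lemma subspace_lie_algebra: "subspace lie_alg"
  by (rule subspaceI)
    (auto intro!: lie_algebraI simp: lie_algebra_translate lie_algebra_vector_field fun_eq_iff scaleR_fun_apply)

lemma lie_bracket_lie_algebra [simp]:
  assumes "X \<in> lie_alg" "Y \<in> lie_alg"
  shows "lie_bracket X Y \<in> lie_alg"
proof (rule lie_algebraI)
  show "lie_bracket X Y \<in> vector_fields A" using assms by (simp add: lie_algebra_vector_field)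
  show "lie_bracket X Y (f \<circ> mul g) = lie_bracket X Y f \<circ> mul g" for f g
    unfolding lie_bracket_def
    by (simp add: lie_algebra_translate[OF assms(1)] lie_algebra_translate[OF assms(2)]) (simp add: fun_eq_iff)
qed

text \<open>\<open>left_field\<close> is linear and maps the tangent space at \<open>e\<close> onto
  the Lie algebra, so a finite spanning set is carried over.\<close>

lemma lie_algebra_finite_span:
  obtains S where "finite S" "lie_alg \<subseteq> span S"
proof -
  obtain T where T: "finite T" "tangent_space A e \<subseteq> span T" by (rule tangent_space_finite_span)
  have lin: "linear left_field"
    by (rule linearI) (simp_all add: left_field_def fun_eq_iff scaleR_fun_apply)
  have "X \<in> span (left_field ` T)" if "X \<in> lie_alg" for X
    using left_field_value[OF that] value_in_tangent[OF lie_algebra_vector_field[OF that], of e] T(2)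
    unfolding linear_span_image[OF lin] by (metis imageI subsetD)
  then show ?thesis using that[of "left_field ` T"] T(1) by blast
qed

lemma subspace_lower_central_series: "subspace (lower_central_series lie_alg k)"
  by (cases k) (simp_all add: subspace_lie_algebra)

lemma lower_central_series_dec: "lower_central_series lie_alg (Suc k) \<subseteq> lower_central_series lie_alg k"
proof (induction k)
  case 0
  show ?case unfolding lower_central_series.simps by (rule span_minimal[OF _ subspace_lie_algebra]) auto
next
  case (Suc k)
  then show ?case unfolding lower_central_series.simps(2)[of _ "Suc k"]
    by (subst lower_central_series.simps(2)) (intro span_mono, blast)
qed

lemma lie_bracket_lower_central_series:
  "X \<in> lie_alg \<Longrightarrow> Y \<in> lower_central_series lie_alg k \<Longrightarrow> lie_bracket X Y \<in> lower_central_series lie_alg (Suc k)"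
  by (auto intro: span_base)

end

section \<open>The left-invariant connection\<close>

lemma fun_scale_apply: "fun_scale f X h p = f p * X h p"
  by (simp add: fun_scale_def)

locale affine_connection = smooth_manifold A
  for A :: "('a::t2_space, 'e::euclidean_space) atlas" +
  fixes D :: "'a conn"
  assumes connection: "connection A D"
begin

section \<open>Tensoriality of the curvature\<close>

lemma conn_in [simp]: "X \<in> vector_fields A \<Longrightarrow> Y \<in> vector_fields A \<Longrightarrow> D X Y \<in> vector_fields A"
  using connection smooth_functions_0 unfolding connection_def by blast

lemma conn_add_left:
  "\<lbrakk>X \<in> vector_fields A; Y \<in> vector_fields A; Z \<in> vector_fields A\<rbrakk> \<Longrightarrow> D (X + Y) Z = D X Z + D Y Z"
  using connection smooth_functions_0 unfolding connection_def by blast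

lemma conn_scale_left:
  "\<lbrakk>f \<in> smooth_functions A; X \<in> vector_fields A; Y \<in> vector_fields A\<rbrakk> \<Longrightarrow> D (fun_scale f X) Y = fun_scale f (D X Y)"
  using connection unfolding connection_def by blast

lemma conn_add:
  "\<lbrakk>X \<in> vector_fields A; Y \<in> vector_fields A; Z \<in> vector_fields A\<rbrakk> \<Longrightarrow> D X (Y + Z) = D X Y + D X Z"
  using connection smooth_functions_0 unfolding connection_def by blast

lemma conn_leibniz:
  "\<lbrakk>f \<in> smooth_functions A; X \<in> vector_fields A; Y \<in> vector_fields A\<rbrakk> \<Longrightarrow>
    D X (fun_scale f Y) = fun_scale (X f) Y + fun_scale f (D X Y)"
  using connection unfolding connection_def by blast

lemma conn_uminus_left:
  assumes "X \<in> vector_fields A" "Y \<in> vector_fields A"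
  shows "D (- X) Y = - D X Y"
  using conn_scale_left[OF smooth_functions_const[of "-1"] assms] by (simp flip: scaleR_eq_fun_scale)

lemma curvature_in [simp]:
  "\<lbrakk>X \<in> vector_fields A; Y \<in> vector_fields A; Z \<in> vector_fields A\<rbrakk> \<Longrightarrow> curvature D X Y Z \<in> vector_fields A"
  by (simp add: curvature_def)

lemma curvature_skew:
  assumes "X \<in> vector_fields A" "Y \<in> vector_fields A" "Z \<in> vector_fields A"
  shows "curvature D X Y Z = - curvature D Y X Z"
  using assms by (simp add: curvature_def lie_bracket_skew[of X Y] conn_uminus_left)

lemma curvature_add_mid:
  assumes "X \<in> vector_fields A" "Y \<in> vector_fields A" "Y' \<in> vector_fields A" "Z \<in> vector_fields A"
  shows "curvature D X (Y + Y') Z = curvature D X Y Z + curvature D X Y' Z"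
  using assms by (simp add: curvature_def lie_bracket_add conn_add_left conn_add)

text \<open>The derivative term \<open>X f\<close> from the Leibniz rule cancels against the one in
  the bracket of \<open>X\<close> with \<open>f Y\<close>.\<close>

lemma curvature_scale_mid:
  assumes "X \<in> vector_fields A" "Y \<in> vector_fields A" "Z \<in> vector_fields A" "f \<in> smooth_functions A"
  shows "curvature D X (fun_scale f Y) Z = fun_scale f (curvature D X Y Z)"
proof -
  note Xf = vf_smooth[OF assms(1,4)]
  show ?thesis
    by (simp add: assms Xf curvature_def lie_bracket_fun_scale conn_add_left conn_scale_left conn_leibniz)
      (simp add: fun_eq_iff fun_scale_apply algebra_simps)
qed

lemma curvature_add_left:
  assumes "X \<in> vector_fields A" "X' \<in> vector_fields A" "Y \<in> vector_fields A" "Z \<in> vector_fields A"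
  shows "curvature D (X + X') Y Z = curvature D X Y Z + curvature D X' Y Z"
  using curvature_skew[of "X + X'" Y Z] curvature_skew[of X Y Z] curvature_skew[of X' Y Z] assms
  by (simp add: curvature_add_mid)

lemma curvature_scale_left:
  assumes "X \<in> vector_fields A" "Y \<in> vector_fields A" "Z \<in> vector_fields A" "f \<in> smooth_functions A"
  shows "curvature D (fun_scale f X) Y Z = fun_scale f (curvature D X Y Z)"
  using curvature_skew[of "fun_scale f X" Y Z] curvature_skew[of X Y Z] assms
  by (simp add: curvature_scale_mid) (simp add: fun_eq_iff fun_scale_apply)

lemma curvature_add_right:
  assumes "X \<in> vector_fields A" "Y \<in> vector_fields A" "Z \<in> vector_fields A" "Z' \<in> vector_fields A"
  shows "curvature D X Y (Z + Z') = curvature D X Y Z + curvature D X Y Z'"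
  using assms by (simp add: curvature_def conn_add)

text \<open>First-order terms cancel in pairs, and the second-order terms X (Y f) - Y (X f) are
  removed by the bracket term.\<close>

lemma curvature_scale_right:
  assumes "X \<in> vector_fields A" "Y \<in> vector_fields A" "Z \<in> vector_fields A" "f \<in> smooth_functions A"
  shows "curvature D X Y (fun_scale f Z) = fun_scale f (curvature D X Y Z)"
proof -
  note s = vf_smooth[OF assms(1)] vf_smooth[OF assms(2)]
  show ?thesis
    by (simp add: assms s curvature_def conn_add conn_leibniz)
      (simp add: fun_eq_iff fun_scale_apply lie_bracket_def algebra_simps)
qed

end

context lie_grp
begin

section \<open>The form on the Lie algebra\<close>

definition left_form :: "'g two_tensor \<Rightarrow> 'g vfield \<Rightarrow> 'g vfield \<Rightarrow> real" where
  "left_form \<omega> X Y = \<omega> e (value_at X e) (value_at Y e)"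

text \<open>Pairings of left-invariant fields are constant, so derivatives of them drop out: the
  exterior derivative reduces to the algebraic cocycle identity, and metric-type identities to
  identities for \<open>con\<close>.\<close>

lemma tensor_app_left_form:
  assumes "left_invariant_form A mul \<omega>" "X \<in> lie_alg" "Y \<in> lie_alg"
  shows "tensor_app \<omega> X Y = (\<lambda>_. left_form \<omega> X Y)"
proof
  fix p
  have "\<omega> (mul p e) (push_tangent mul p (value_at X e)) (push_tangent mul p (value_at Y e)) = left_form \<omega> X Y"
    using assms(1) value_in_tangent[OF lie_algebra_vector_field[OF assms(2)], of e]
      value_in_tangent[OF lie_algebra_vector_field[OF assms(3)], of e]
    unfolding left_invariant_form_def left_form_def by blast
  then show "tensor_app \<omega> X Y p = left_form \<omega> X Y"
    by (simp add: tensor_app_def value_lie_algebra[OF assms(2), of p] value_lie_algebra[OF assms(3), of p])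
qed

lemma left_form_frame_exists:
  assumes \<omega>: "symplectic_form A \<omega>"
  obtains B F where "symplectic_vector_space lie_alg (left_form \<omega>) B F"
proof -
  interpret two_form_manifold A \<omega>
    using \<omega> by unfold_locales (simp add: symplectic_form_def)
  obtain S where S: "finite S" "lie_alg \<subseteq> span S" by (rule lie_algebra_finite_span)
  note T = value_in_tangent[OF lie_algebra_vector_field, of _ e]
  show ?thesis
  proof (rule symplectic_vector_space_exists[OF subspace_lie_algebra S, of "left_form \<omega>"])
    fix X assume X: "X \<in> lie_alg" and *: "\<And>Y. Y \<in> lie_alg \<Longrightarrow> left_form \<omega> X Y = 0"
    have "\<omega> e (value_at X e) v = 0" if "v \<in> tangent_space A e" for v
      using left_field_exists[OF that] * unfolding left_form_def by metis
    then have "value_at X e = 0" using \<omega> T[OF X] unfolding symplectic_form_def by blast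
    then show "X = 0" using left_field_value[OF X] by (simp add: left_field_def fun_eq_iff)
  next
    fix B F assume "symplectic_vector_space lie_alg (left_form \<omega>) B F"
    then show ?thesis by (rule that)
  next
    fix X Y assume "X \<in> lie_alg" "Y \<in> lie_alg"
    then show "left_form \<omega> X Y = - left_form \<omega> Y X"
      unfolding left_form_def by (intro form_skew T)
  qed (simp_all add: left_form_def value_add value_scaleR form_add form_scaleR T)
qed

end

locale left_symplectic_frame = lie_grp A mul e iv
  for A :: "('g::{t2_space,second_countable_topology}, 'e::euclidean_space) atlas"
    and mul :: "'g \<Rightarrow> 'g \<Rightarrow> 'g" and e :: 'g and iv :: "'g \<Rightarrow> 'g" +
  fixes \<omega> :: "'g two_tensor" and B :: "'g vfield set" and F :: "'g vfield \<Rightarrow> 'g vfield"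
  assumes symplectic: "symplectic_form A \<omega>"
    and left_invariant: "left_invariant_form A mul \<omega>"
    and frame: "symplectic_vector_space lie_alg (left_form \<omega>) B F"
begin

sublocale two_form_manifold A \<omega>
  using symplectic by unfold_locales (simp add: symplectic_form_def)

sublocale alg: symplectic_vector_space lie_alg "left_form \<omega>" B F
  by (rule frame)

lemmas lie_vf [simp] = lie_algebra_vector_field

lemmas tensor_app_lie = tensor_app_left_form[OF left_invariant]

sublocale alg: symplectic_lie_algebra lie_alg "left_form \<omega>" B F lie_bracket
proof unfold_locales
  fix X Y Z assume XYZ: "X \<in> lie_alg" "Y \<in> lie_alg" "Z \<in> lie_alg"
  have "exterior_derivative \<omega> X Y Z e = 0"
    using symplectic XYZ by (simp add: symplectic_form_def)
  then have "- left_form \<omega> (lie_bracket X Y) Z + left_form \<omega> (lie_bracket X Z) Y - left_form \<omega> (lie_bracket Y Z) X = 0"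
    using XYZ by (simp add: exterior_derivative_def tensor_app_lie vf_const)
  then show "left_form \<omega> (lie_bracket X Y) Z + left_form \<omega> (lie_bracket Y Z) X + left_form \<omega> (lie_bracket Z X) Y = 0"
    using XYZ by (simp add: lie_bracket_skew[of Z X] alg.w_minus)
next
  show "lie_bracket X Y = - lie_bracket Y X" for X Y by (rule lie_bracket_skew)
qed (simp_all add: lie_bracket_add lie_bracket_scaleR lie_bracket_jacobi)

text \<open>Bracketing with \<open>X\<close> shifts the lower central series by one step and two
  brackets by two, hence at least one; both operators respect the filtration argument.\<close>

lemma tr_ad_nilpotent:
  assumes k: "lower_central_series lie_alg k = {0}"
  shows "X \<in> lie_alg \<Longrightarrow> alg.tr (lie_bracket X) = 0"
    and "X \<in> lie_alg \<Longrightarrow> Y \<in> lie_alg \<Longrightarrow> alg.tr (\<lambda>Z. lie_bracket X (lie_bracket Y Z)) = 0"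
proof -
  note tr0 = alg.tr_filtered_nilpotent[where W = "lower_central_series lie_alg", OF _ _
    subspace_lower_central_series lower_central_series_dec _ k]
  show "alg.tr (lie_bracket X) = 0" if "X \<in> lie_alg"
    by (rule tr0[OF alg.lin_br[OF that]])
      (use that lie_bracket_lower_central_series in auto)
  show "alg.tr (\<lambda>Z. lie_bracket X (lie_bracket Y Z)) = 0" if "X \<in> lie_alg" "Y \<in> lie_alg"
  proof (rule tr0[OF alg.lin_compose[OF alg.lin_br[OF that(1)] alg.lin_br[OF that(2)]]])
    fix i Z assume "Z \<in> lower_central_series lie_alg i"
    then show "lie_bracket X (lie_bracket Y Z) \<in> lower_central_series lie_alg (Suc i)"
      using lie_bracket_lower_central_series[OF that(2)] lower_central_series_dec
        lie_bracket_lower_central_series[OF that(1)] by blast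
  qed simp
qed

section \<open>Coframe, tensorial reduction and the connection\<close>

definition coframe :: "'g vfield \<Rightarrow> 'g vfield \<Rightarrow> 'g \<Rightarrow> real" where
  "coframe b X = tensor_app \<omega> X (F b)"

lemma coframe_smooth [simp]: "b \<in> B \<Longrightarrow> X \<in> vector_fields A \<Longrightarrow> coframe b X \<in> smooth_functions A"
  by (simp add: coframe_def)

lemma coframe_add:
  "\<lbrakk>b \<in> B; X \<in> vector_fields A; Y \<in> vector_fields A\<rbrakk> \<Longrightarrow> coframe b (X + Y) = coframe b X + coframe b Y"
  by (simp add: coframe_def tensor_app_add)

lemma coframe_scale:
  "\<lbrakk>b \<in> B; X \<in> vector_fields A\<rbrakk> \<Longrightarrow> coframe b (fun_scale f X) = f * coframe b X"
  by (simp add: coframe_def tensor_app_fun_scale[of X X])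

lemma coframe_lie: "\<lbrakk>b \<in> B; X \<in> lie_alg\<rbrakk> \<Longrightarrow> coframe b X = (\<lambda>_. left_form \<omega> X (F b))"
  by (simp add: coframe_def tensor_app_lie)

text \<open>Extend \<open>v\<close> to a left-invariant field and expand that in the Lie algebra;
  the constant coefficients can be read off at \<open>p\<close>.\<close>

lemma tangent_frame_expand:
  assumes v: "v \<in> tangent_space A p"
  shows "v = (\<Sum>b\<in>B. \<omega> p v (value_at (F b) p) *\<^sub>R value_at b p)"
proof -
  obtain X where X: "X \<in> lie_alg" "value_at X p = v" using left_field_exists[OF v] by blast
  have "left_form \<omega> X (F b) = \<omega> p v (value_at (F b) p)" if "b \<in> B" for b
    using fun_cong[OF tensor_app_lie[OF X(1) alg.F_in[OF that]], of p] X(2) by (simp add: tensor_app_def)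
  then have "value_at (\<Sum>b\<in>B. left_form \<omega> X (F b) *\<^sub>R b) p = (\<Sum>b\<in>B. \<omega> p v (value_at (F b) p) *\<^sub>R value_at b p)"
    by (simp add: value_sum value_scaleR)
  then show ?thesis using alg.expand[OF X(1)] X(2) by simp
qed

lemma vf_frame_expand:
  assumes "X \<in> vector_fields A"
  shows "X = (\<Sum>b\<in>B. fun_scale (coframe b X) b)"
proof (intro ext)
  fix h p
  show "X h p = (\<Sum>b\<in>B. fun_scale (coframe b X) b) h p"
    using fun_cong[OF tangent_frame_expand[OF value_in_tangent[OF assms, of p]], of h]
    by (simp add: value_at_def sum_fun_apply scaleR_fun_apply fun_scale_apply coframe_def tensor_app_def)
qed

text \<open>\<open>T\<close> is a tensorial expression evaluated at \<open>p\<close>. Since the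
  frame is global, additivity and scaling alone reduce it to frame elements.\<close>

lemma tensorial_expand:
  assumes X: "X \<in> vector_fields A"
    and add: "\<And>X Y. \<lbrakk>X \<in> vector_fields A; Y \<in> vector_fields A\<rbrakk> \<Longrightarrow> T (X + Y) = T X + T Y"
    and scale: "\<And>f X. \<lbrakk>f \<in> smooth_functions A; X \<in> vector_fields A\<rbrakk> \<Longrightarrow> T (fun_scale f X) = f p * T X"
  shows "T X = (\<Sum>b\<in>B. coframe b X p * T b :: real)"
proof -
  have "fun_scale 0 0 = (0 :: 'g vfield)" by (simp add: fun_scale_def fun_eq_iff)
  then have T0: "T 0 = 0" using scale[of 0 0] by simp
  have vf: "fun_scale (coframe b X) b \<in> vector_fields A" if "b \<in> B" for b
    using that X by simp
  have "T (\<Sum>b\<in>C. fun_scale (coframe b X) b) = (\<Sum>b\<in>C. coframe b X p * T b)" if "C \<subseteq> B" for C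
    using finite_subset[OF that alg.finite_B] that
    by (induction C rule: finite_induct) (simp_all add: T0 X add scale vf subset_iff)
  from this[OF order_refl] show ?thesis
    by (rule trans[OF arg_cong[OF vf_frame_expand[OF X], of T]])
qed

lemma tensorial_vanish:
  assumes "X \<in> vector_fields A"
    and "\<And>X Y. \<lbrakk>X \<in> vector_fields A; Y \<in> vector_fields A\<rbrakk> \<Longrightarrow> T (X + Y) = T X + T Y"
    and "\<And>f X. \<lbrakk>f \<in> smooth_functions A; X \<in> vector_fields A\<rbrakk> \<Longrightarrow> T (fun_scale f X) = f p * T X"
    and "\<And>X. X \<in> lie_alg \<Longrightarrow> T X = (0::real)"
  shows "T X = 0"
proof -
  have "T X = (\<Sum>b\<in>B. coframe b X p * T b)" by (rule tensorial_expand[OF assms(1-3)])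
  also have "\<dots> = 0" using assms(4) by (intro sum.neutral) simp
  finally show ?thesis .
qed

text \<open>Writing \<open>Y\<close> in the frame, the Leibniz rule forces this formula once
  \<open>con\<close> is prescribed on frame elements; the first sum differentiates the
  coefficients.\<close>

definition left_conn :: "'g conn" where
  "left_conn X Y = (\<Sum>b\<in>B. fun_scale (X (coframe b Y)) b) +
     (\<Sum>b\<in>B. \<Sum>c\<in>B. fun_scale (coframe b X * coframe c Y) (alg.con b c))"

lemma left_conn_apply:
  "left_conn X Y h p = (\<Sum>b\<in>B. X (coframe b Y) p * b h p) +
     (\<Sum>b\<in>B. \<Sum>c\<in>B. coframe b X p * coframe c Y p * alg.con b c h p)"
  by (simp add: left_conn_def sum_fun_apply fun_scale_apply)

lemma con_vf [simp]: "X \<in> lie_alg \<Longrightarrow> Y \<in> lie_alg \<Longrightarrow> alg.con X Y \<in> vector_fields A"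
  by (rule lie_vf) simp

lemma left_conn_connection: "connection A left_conn"
  unfolding connection_def
proof (intro ballI conjI)
  fix X Y Z f
  assume X: "X \<in> vector_fields A" and Y: "Y \<in> vector_fields A" and Z: "Z \<in> vector_fields A"
    and f: "f \<in> smooth_functions A"
  show "left_conn X Y \<in> vector_fields A"
    unfolding left_conn_def
    by (intro vector_fields_add vector_fields_sum vector_fields_fun_scale smooth_functions_mult
        vf_smooth[OF X] coframe_smooth X Y) simp_all
  show "left_conn (X + Y) Z = left_conn X Z + left_conn Y Z"
    by (intro ext) (simp add: left_conn_apply coframe_add X Y algebra_simps sum.distrib)
  show "left_conn (fun_scale f X) Y = fun_scale f (left_conn X Y)"
    by (intro ext) (simp add: left_conn_apply coframe_scale fun_scale_apply X algebra_simps sum_distrib_left)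
  show "left_conn X (Y + Z) = left_conn X Y + left_conn X Z"
    by (intro ext) (simp add: left_conn_apply coframe_add vf_simps[OF X] Y Z algebra_simps sum.distrib)
  show "left_conn X (fun_scale f Y) = fun_scale (X f) Y + fun_scale f (left_conn X Y)"
  proof (intro ext)
    fix h p
    \<comment> \<open>Differentiating the scaled coefficients leaves \<open>X f\<close> times this
      expansion, which reassembles \<open>Y\<close>.\<close>
    have "Y h p = (\<Sum>b\<in>B. coframe b Y p * b h p)"
      using fun_cong[OF fun_cong[OF vf_frame_expand[OF Y], of h], of p]
      by (simp add: sum_fun_apply fun_scale_apply)
    then show "left_conn X (fun_scale f Y) h p = (fun_scale (X f) Y + fun_scale f (left_conn X Y)) h p"
      by (simp add: left_conn_apply coframe_scale fun_scale_apply vf_simps[OF X] Y f algebra_simps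
          sum_distrib_left sum.distrib)
  qed
qed

sublocale conn: affine_connection A left_conn
  by unfold_locales (rule left_conn_connection)

text \<open>Coefficients of left-invariant fields are constant, so the derivative sum vanishes and
  bilinearity of \<open>con\<close> does the rest.\<close>

lemma left_conn_lie:
  assumes X: "X \<in> lie_alg" and Y: "Y \<in> lie_alg"
  shows "left_conn X Y = alg.con X Y"
proof (intro ext)
  fix h p
  have "alg.con X Y = (\<Sum>b\<in>B. left_form \<omega> X (F b) *\<^sub>R alg.con b Y)"
    using alg.lin_expand[OF alg.lin_con_left[OF Y] X] .
  also have "\<dots> = (\<Sum>b\<in>B. left_form \<omega> X (F b) *\<^sub>R (\<Sum>c\<in>B. left_form \<omega> Y (F c) *\<^sub>R alg.con b c))"
    by (intro sum.cong refl arg_cong2[where f = scaleR] alg.lin_expand[OF alg.lin_con Y]) simp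
  finally show "left_conn X Y h p = alg.con X Y h p"
    using X Y by (simp add: left_conn_apply coframe_lie vf_const sum_fun_apply scaleR_fun_apply
        sum_distrib_left mult.assoc)
qed

lemma left_conn_left_invariant: "left_invariant_connection A mul iv left_conn"
  unfolding left_invariant_connection_def
proof (intro allI ballI ext)
  fix g X Y h p assume X: "X \<in> vector_fields A" and Y: "Y \<in> vector_fields A"
  \<comment> \<open>Both the form and \<open>F b\<close> are left-invariant, so the coefficient
    functions are merely translated.\<close>
  have coframe_push: "coframe b (push_field mul iv g Z) = coframe b Z \<circ> mul (iv g)"
    if b: "b \<in> B" and Z: "Z \<in> vector_fields A" for b Z
  proof
    fix q
    have "push_field mul iv g (F b) = F b"
      using alg.F_in[OF b] unfolding lie_algebra_def by blast
    then have "value_at (F b) q = push_tangent mul g (value_at (F b) (mul (iv g) q))"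
      using value_push_field[of g "F b" q] by simp
    then have "coframe b (push_field mul iv g Z) q =
      \<omega> (mul g (mul (iv g) q)) (push_tangent mul g (value_at Z (mul (iv g) q)))
        (push_tangent mul g (value_at (F b) (mul (iv g) q)))"
      by (simp add: coframe_def tensor_app_def value_push_field)
    also have "\<dots> = \<omega> (mul (iv g) q) (value_at Z (mul (iv g) q)) (value_at (F b) (mul (iv g) q))"
      by (rule left_invariant[unfolded left_invariant_form_def, rule_format,
            OF value_in_tangent[OF Z] value_in_tangent[OF lie_vf[OF alg.F_in[OF b]]]])
    finally show "coframe b (push_field mul iv g Z) q = (coframe b Z \<circ> mul (iv g)) q"
      by (simp add: coframe_def tensor_app_def)
  qed
  have lie: "Z (h \<circ> mul g) (mul (iv g) p) = Z h p" if "Z \<in> lie_alg" for Z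
    using lie_algebra_translate[OF that, of h g] by simp
  have "push_field mul iv g X (coframe b Y \<circ> mul (iv g)) p = X (coframe b Y) (mul (iv g) p)" for b
    by (simp add: push_field_def)
  moreover have "push_field mul iv g (left_conn X Y) h p = left_conn X Y (h \<circ> mul g) (mul (iv g) p)"
    by (simp add: push_field_def)
  ultimately show "left_conn (push_field mul iv g X) (push_field mul iv g Y) h p =
      push_field mul iv g (left_conn X Y) h p"
    by (simp add: left_conn_apply coframe_push X Y lie)
qed

text \<open>The torsion is skew, so tensoriality in the second slot alone reduces both slots to the
  Lie algebra.\<close>

lemma left_conn_torsion_free: "torsion_free A left_conn"
  unfolding torsion_free_def
proof (intro ballI ext)
  fix X Y h p assume X: "X \<in> vector_fields A" and Y: "Y \<in> vector_fields A"
  define T where "T = (\<lambda>X Y. (left_conn X Y - left_conn Y X - lie_bracket X Y) h p)"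
  have add: "T X (Y + Z) = T X Y + T X Z"
    if "X \<in> vector_fields A" "Y \<in> vector_fields A" "Z \<in> vector_fields A" for X Y Z
    using that by (simp add: T_def conn.conn_add conn.conn_add_left lie_bracket_add)
  have scale: "T X (fun_scale f Y) = f p * T X Y"
    if "X \<in> vector_fields A" "Y \<in> vector_fields A" "f \<in> smooth_functions A" for X Y f
    using that by (simp add: T_def conn.conn_leibniz conn.conn_scale_left lie_bracket_fun_scale
        fun_scale_apply algebra_simps)
  have skew: "T X Y = - T Y X" for X Y
    by (simp add: T_def lie_bracket_skew[of X Y])
  have "T X Y = 0" if "X \<in> lie_alg" "Y \<in> lie_alg" for X Y
    using that fun_cong[OF fun_cong[OF alg.con_torsion_free[OF that], of h], of p]
    by (simp add: T_def left_conn_lie)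
  then have "T X Y = 0" if "X \<in> lie_alg" for X
    using that add scale by (intro tensorial_vanish[OF Y, of "T X" p]) simp_all
  then have "T Y X = 0"
    using skew[of Y] add[OF Y] scale[OF Y] by (intro tensorial_vanish[OF X, of "T Y" p]) simp_all
  then show "(left_conn X Y - left_conn Y X) h p = lie_bracket X Y h p"
    using skew[of X Y] by (simp add: T_def)
qed

lemma left_conn_symplectic: "symplectic_connection A \<omega> left_conn"
  unfolding symplectic_connection_def
proof (intro ballI ext)
  fix X Y Z p
  assume X: "X \<in> vector_fields A" and Y: "Y \<in> vector_fields A" and Z: "Z \<in> vector_fields A"
  define S where "S = (\<lambda>X Y Z. covariant_derivative left_conn \<omega> X Y Z p)"
  have add1: "S (X + X') Y Z = S X Y Z + S X' Y Z"
    if "X \<in> vector_fields A" "X' \<in> vector_fields A" "Y \<in> vector_fields A" "Z \<in> vector_fields A" for X X' Y Z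
    using that by (simp add: S_def covariant_derivative_def conn.conn_add_left tensor_app_add
        tensor_app_add_right[OF _ _ _ smooth_functions_0])
  have scale1: "S (fun_scale f X) Y Z = f p * S X Y Z"
    if "f \<in> smooth_functions A" "X \<in> vector_fields A" "Y \<in> vector_fields A" "Z \<in> vector_fields A" for f X Y Z
    using that by (simp add: S_def covariant_derivative_def conn.conn_scale_left
        tensor_app_fun_scale[of X X] tensor_app_fun_scale[of _ X] tensor_app_fun_scale_right[of _ X]
        fun_scale_apply algebra_simps)
  have add2: "S X (Y + Y') Z = S X Y Z + S X Y' Z"
    if "X \<in> vector_fields A" "Y \<in> vector_fields A" "Y' \<in> vector_fields A" "Z \<in> vector_fields A" for X Y Y' Z
    using that by (simp add: S_def covariant_derivative_def conn.conn_add tensor_app_add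
        vf_add[OF that(1)])
  have scale2: "S X (fun_scale f Y) Z = f p * S X Y Z"
    if "f \<in> smooth_functions A" "X \<in> vector_fields A" "Y \<in> vector_fields A" "Z \<in> vector_fields A" for f X Y Z
    using that vf_smooth[OF that(2,1)]
    by (simp add: S_def covariant_derivative_def conn.conn_leibniz tensor_app_add
        tensor_app_fun_scale[of _ X] vf_mult[OF that(2)] fun_scale_apply algebra_simps)
  \<comment> \<open>Skewness moves the third slot into the second, the one of the two whose
    linearity has been checked.\<close>
  have skew: "S X Y Z = - S X Z Y"
    if "X \<in> vector_fields A" "Y \<in> vector_fields A" "Z \<in> vector_fields A" for X Y Z
  proof -
    have "X (- f) = - X f" if "f \<in> smooth_functions A" for f
      using vf_scaleR[OF \<open>X \<in> _\<close> that, of "-1"] by simp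
    then show ?thesis
      using that tensor_app_skew[of Y Z] tensor_app_skew[of "left_conn X Y" Z]
        tensor_app_skew[of Y "left_conn X Z"]
      by (simp add: S_def covariant_derivative_def)
  qed
  have lie: "S X Y Z = 0" if "X \<in> lie_alg" "Y \<in> lie_alg" "Z \<in> lie_alg" for X Y Z
    using that alg.con_symplectic[OF that]
    by (simp add: S_def covariant_derivative_def tensor_app_lie left_conn_lie vf_const)
  have lie2: "S X Y Z = 0" if "X \<in> lie_alg" "Y \<in> lie_alg" for X Y
  proof -
    have "S X Z Y = 0"
      using lie that by (intro tensorial_vanish[OF Z, of "\<lambda>Z. S X Z Y" p]) (simp_all add: add2 scale2)
    then show ?thesis using skew[of X Y Z] that Z by simp
  qed
  have lie1: "S X Y Z = 0" if "X \<in> lie_alg" for X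
    using lie2 that Z by (intro tensorial_vanish[OF Y, of "\<lambda>Y. S X Y Z" p]) (simp_all add: add2 scale2)
  have "S X Y Z = 0"
    using lie1 Y Z by (intro tensorial_vanish[OF X, of "\<lambda>X. S X Y Z" p]) (simp_all add: add1 scale1)
  then show "covariant_derivative left_conn \<omega> X Y Z p = 0 p" by (simp add: S_def)
qed

lemma left_conn_ricci_flat:
  assumes k: "lower_central_series lie_alg k = {0}"
  shows "ricci_flat A left_conn"
  unfolding ricci_flat_def
proof (intro ballI allI)
  fix X Y p assume X: "X \<in> vector_fields A" and Y: "Y \<in> vector_fields A"
  define R where "R = (\<lambda>X Y. \<Sum>b\<in>B. coframe b (curvature left_conn X b Y) p)"
  \<comment> \<open>In the frame, \<open>u \<mapsto> R(X, u) Y\<close> is a sum of rank-one maps: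
    the coordinate functional at \<open>b\<close> times \<open>R(X, b) Y\<close>.\<close>
  have "ricci A left_conn X Y p = (\<Sum>b\<in>B. \<omega> p (value_at (curvature left_conn X b Y) p) (value_at (F b) p))"
    unfolding ricci_def
  proof (rule trace_on_rank_one[OF subspace_tangent_space, where \<alpha> = "\<lambda>b u. \<omega> p u (value_at (F b) p)"])
    show "finite ((\<lambda>b. value_at b p) ` B)" using alg.finite_B by simp
    show "tangent_space A p \<subseteq> span ((\<lambda>b. value_at b p) ` B)"
    proof
      fix v assume "v \<in> tangent_space A p"
      then show "v \<in> span ((\<lambda>b. value_at b p) ` B)"
        by (subst tangent_frame_expand) (auto intro!: span_sum span_scale intro: span_base)
    qed
    fix u assume u: "u \<in> tangent_space A p"
    obtain Z0 where "Z0 \<in> lie_alg" "value_at Z0 p = u" using left_field_exists[OF u] by blast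
    then have "Z0 \<in> vector_fields A \<and> value_at Z0 p = u" by simp
    \<comment> \<open>A left-invariant extension witnesses the \<open>SOME\<close>; which field it
      returns is immaterial, the curvature being tensorial in this slot.\<close>
    then have Z: "extend_field A p u \<in> vector_fields A" "value_at (extend_field A p u) p = u"
      unfolding extend_field_def by (metis (mono_tags, lifting) someI)+
    show "value_at (curvature left_conn X (extend_field A p u) Y) p =
      (\<Sum>b\<in>B. \<omega> p u (value_at (F b) p) *\<^sub>R value_at (curvature left_conn X b Y) p)"
    proof
      fix h
      have "curvature left_conn X (extend_field A p u) Y h p =
        (\<Sum>b\<in>B. coframe b (extend_field A p u) p * curvature left_conn X b Y h p)"
        by (rule tensorial_expand[OF Z(1), where T = "\<lambda>Z. curvature left_conn X Z Y h p"])
          (simp_all add: X Y conn.curvature_add_mid conn.curvature_scale_mid fun_scale_apply)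
      then show "value_at (curvature left_conn X (extend_field A p u) Y) p h =
        (\<Sum>b\<in>B. \<omega> p u (value_at (F b) p) *\<^sub>R value_at (curvature left_conn X b Y) p) h"
        by (simp add: value_at_def[of "curvature _ _ _ _"] sum_fun_apply scaleR_fun_apply coframe_def tensor_app_def Z(2))
    qed
  qed (simp_all add: form_add form_scaleR value_in_tangent X Y)
  also have "\<dots> = R X Y" by (simp add: R_def coframe_def tensor_app_def)
  \<comment> \<open>The contraction is still tensorial in \<open>X\<close> and in \<open>Y\<close>,
    so both may be taken in the Lie algebra.\<close>
  also have "R X Y = 0"
  proof (rule tensorial_vanish[OF X, where p = p and T = "\<lambda>X. R X Y"])
    fix X assume X: "X \<in> lie_alg"
    show "R X Y = 0"
    proof (rule tensorial_vanish[OF Y, where p = p and T = "R X"])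
      fix Y assume Y: "Y \<in> lie_alg"
      \<comment> \<open>On left-invariant fields \<open>coframe b\<close> is the constant coordinate
        functional, so the contraction becomes the algebraic trace.\<close>
      have "R X Y = alg.tr (\<lambda>Z. alg.con X (alg.con Z Y) - alg.con Z (alg.con X Y) - alg.con (lie_bracket X Z) Y)"
        unfolding R_def alg.tr_def using X Y
        by (intro sum.cong) (simp_all add: curvature_def left_conn_lie coframe_lie)
      then show "R X Y = 0"
        using alg.con_ricci_flat[OF tr_ad_nilpotent[OF k]] X Y by simp
    qed (simp_all add: R_def X conn.curvature_add_right conn.curvature_scale_right coframe_add coframe_scale
        sum.distrib sum_distrib_left)
  qed (simp_all add: R_def Y conn.curvature_add_left conn.curvature_scale_left coframe_add coframe_scale
      sum.distrib sum_distrib_left)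
  finally show "ricci A left_conn X Y p = 0" .
qed

end

theorem theorem4:
  fixes A :: "('g::{t2_space,second_countable_topology}, 'e::euclidean_space) atlas"
    and mul :: "'g \<Rightarrow> 'g \<Rightarrow> 'g" and e :: 'g and iv :: "'g \<Rightarrow> 'g"
    and \<omega> :: "'g two_tensor"
  assumes "nilpotent_lie_group A mul e iv"
    and "symplectic_form A \<omega>"
    and "left_invariant_form A mul \<omega>"
  shows "\<exists>D. connection A D \<and> left_invariant_connection A mul iv D \<and> torsion_free A D \<and>
           symplectic_connection A \<omega> D \<and> ricci_flat A D"
proof -
  interpret lie_grp A mul e iv
    using assms(1) by unfold_locales (simp add: nilpotent_lie_group_def)
  obtain B F where "symplectic_vector_space lie_alg (left_form \<omega>) B F"
    by (rule left_form_frame_exists[OF assms(2)])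
  then interpret left_symplectic_frame A mul e iv \<omega> B F
    by (intro left_symplectic_frame.intro left_symplectic_frame_axioms.intro lie_grp_axioms assms(2,3))
  obtain k where "lower_central_series lie_alg k = {0}"
    using assms(1) by (auto simp: nilpotent_lie_group_def)
  then show ?thesis
    using left_conn_connection left_conn_left_invariant left_conn_torsion_free left_conn_symplectic
      left_conn_ricci_flat by blast
qed

end
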